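(* Let $h_1,h_2,h_3\in\mathbb{R}$ with $h_1^2\geq h_2^2\geq h_3^2$ and $P>0$. The sum-capacity $C_N$ of the (non-restricted) Gaussian Y-channel with gains $h_1,h_2,h_3$ and power $P$ satisfies $$C_N\leq C((h_2^2+h_3^2)P)+C(\min\{h_1^2+h_3^2,(|h_2|+|h_3|)^2\}P).$$
   Context: $C(x)=\frac12\log_2(1+x)$. The (non-restricted, reciprocal) Gaussian Y-channel with real gains $h_1,h_2,h_3$ and power $P>0$: there are users $1,2,3$ and a relay $r$. For each ordered pair $(j,k)$ of distinct indices in $\{1,2,3\}$, user $j$ holds a message $m_{jk}$, uniform on $\{1,\dots,2^{nR_{jk}}\}$, intended for user $k$; the six messages are mutually independent. Over channel uses $i=1,\dots,n$, the relay receives $Y_{ri}=h_1X_{1i}+h_2X_{2i}+h_3X_{3i}+Z_{ri}$ and user $j$ receives $Y_{ji}=h_jX_{ri}+Z_{ji}$, all noise samples i.i.d. $\mathcal N(0,1)$ independent of the messages. A code of length $n$: encoders $X_{ji}=f_{ji}(m_{jk},m_{jl},Y_j^{i-1})$ ($\{k,l\}=\{1,2,3\}\setminus\{j\}$), relay encoders $X_{ri}=f_{ri}(Y_r^{i-1})$, power constraints $\frac1n\sum_i\mathbb E[X_{ai}^2]\le P$ for $a\in\{1,2,3,r\}$, and decoders by which user $j$ estimates $(m_{kj},m_{lj})$ from $(Y_j^n,m_{jk},m_{jl})$. A rate tuple $(R_{jk})_{j\ne k}$ is achievable if there exist codes whose error probability (some message decoded wrongly) tends to $0$ as $n\to\infty$.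 $C_N$ is the supremum of $\sum_{j\ne k}R_{jk}$ over achievable tuples. *)

theory Defs
  imports "HOL-Probability.Probability"
begin

definition Cap :: "real \<Rightarrow> real" where
  "Cap x = 1/2 * log 2 (1 + x)"

text \<open>Users are 1,2,3; node 0 is the relay. Time indices are 0..n-1
  (time i here corresponds to channel use i+1 in the paper).\<close>
definition users :: "nat set" where "users = {1,2,3}"

definition pairs :: "(nat \<times> nat) set" where
  "pairs = {(j,k). j \<in> users \<and> k \<in> users \<and> j \<noteq> k}"

definition gain :: "real \<Rightarrow> real \<Rightarrow> real \<Rightarrow> nat \<Rightarrow> real" where
  "gain h1 h2 h3 j = (if j = 1 then h1 else if j = 2 then h2 else h3)"

text \<open>A code: enc j i (m_j) y  is user j's input at time i, given its own messages
  m_j = (\<lambda>k. m j k) (only the entries k in users - {j} carry information, the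
  others are fixed to 1) and its past outputs y = Y_j^{i-1};
  rel i y is the relay input at time i given Y_r^{i-1};
  dec j (m_j) y is user j's estimate (\<lambda>k. estimate of m k j) from Y_j^n and its own messages.\<close>
record code =
  enc :: "nat \<Rightarrow> nat \<Rightarrow> (nat \<Rightarrow> nat) \<Rightarrow> real list \<Rightarrow> real"
  rel :: "nat \<Rightarrow> real list \<Rightarrow> real"
  dec :: "nat \<Rightarrow> (nat \<Rightarrow> nat) \<Rightarrow> real list \<Rightarrow> (nat \<Rightarrow> nat)"

text \<open>Output histories after i channel uses: hist .. i 0 = Y_r^i, hist .. i j = Y_j^i,
  driven by messages m and the noise realisation \<omega> (\<omega> (a,i) = noise at node a, time i).\<close>
primrec hist :: "real \<Rightarrow> real \<Rightarrow> real \<Rightarrow> code \<Rightarrow> (nat \<Rightarrow> nat \<Rightarrow> nat) \<Rightarrow> (nat \<times> nat \<Rightarrow> real)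
                  \<Rightarrow> nat \<Rightarrow> nat \<Rightarrow> real list" where
  "hist h1 h2 h3 c m \<omega> 0 = (\<lambda>a. [])"
| "hist h1 h2 h3 c m \<omega> (Suc i) =
     (let H = hist h1 h2 h3 c m \<omega> i;
          xr = rel c i (H 0)
      in (\<lambda>a. if a = 0 then
                 H 0 @ [(\<Sum>j\<in>users. gain h1 h2 h3 j * enc c j i (m j) (H j)) + \<omega> (0, i)]
               else if a \<in> users then H a @ [gain h1 h2 h3 a * xr + \<omega> (a, i)]
               else []))"

definition inp :: "real \<Rightarrow> real \<Rightarrow> real \<Rightarrow> code \<Rightarrow> (nat \<Rightarrow> nat \<Rightarrow> nat) \<Rightarrow> (nat \<times> nat \<Rightarrow> real)
                  \<Rightarrow> nat \<Rightarrow> nat \<Rightarrow> real" where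
  "inp h1 h2 h3 c m \<omega> a i =
     (if a = 0 then rel c i (hist h1 h2 h3 c m \<omega> i 0)
      else enc c a i (m a) (hist h1 h2 h3 c m \<omega> i a))"

definition nmsg :: "nat \<Rightarrow> real \<Rightarrow> nat" where
  "nmsg n r = nat \<lceil>2 powr (real n * r)\<rceil>"

definition msgs :: "nat \<Rightarrow> (nat \<Rightarrow> nat \<Rightarrow> real) \<Rightarrow> (nat \<Rightarrow> nat \<Rightarrow> nat) set" where
  "msgs n R = {m. \<forall>j k. (if (j,k) \<in> pairs then m j k \<in> {1..nmsg n (R j k)} else m j k = 1)}"

definition noise :: "nat \<Rightarrow> (nat \<times> nat \<Rightarrow> real) measure" where
  "noise n = PiM ({0..3} \<times> {..<n}) (\<lambda>_. density lborel std_normal_density)"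

definition err_event :: "real \<Rightarrow> real \<Rightarrow> real \<Rightarrow> nat \<Rightarrow> code \<Rightarrow> (nat \<Rightarrow> nat \<Rightarrow> nat)
                         \<Rightarrow> (nat \<times> nat \<Rightarrow> real) set" where
  "err_event h1 h2 h3 n c m = {\<omega> \<in> space (noise n).
      \<exists>(k,j)\<in>pairs. dec c j (m j) (hist h1 h2 h3 c m \<omega> n j) k \<noteq> m k j}"

definition perr :: "real \<Rightarrow> real \<Rightarrow> real \<Rightarrow> nat \<Rightarrow> (nat \<Rightarrow> nat \<Rightarrow> real) \<Rightarrow> code \<Rightarrow> real" where
  "perr h1 h2 h3 n R c =
     (\<Sum>m\<in>msgs n R. measure (noise n) (err_event h1 h2 h3 n c m)) / real (card (msgs n R))"

definition avg_power :: "real \<Rightarrow> real \<Rightarrow> real \<Rightarrow> nat \<Rightarrow> (nat \<Rightarrow> nat \<Rightarrow> real) \<Rightarrow> code \<Rightarrow> nat \<Rightarrow> real" where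
  "avg_power h1 h2 h3 n R c a =
     (1 / real n) * (\<Sum>i<n. (\<Sum>m\<in>msgs n R. integral\<^sup>L (noise n) (\<lambda>\<omega>. (inp h1 h2 h3 c m \<omega> a i)\<^sup>2))
                                / real (card (msgs n R)))"

definition valid_code :: "real \<Rightarrow> real \<Rightarrow> real \<Rightarrow> real \<Rightarrow> nat \<Rightarrow> (nat \<Rightarrow> nat \<Rightarrow> real) \<Rightarrow> code \<Rightarrow> bool" where
  "valid_code h1 h2 h3 P n R c \<longleftrightarrow>
     (\<forall>m\<in>msgs n R. \<forall>a\<in>{0..3}. \<forall>i<n.
        (\<lambda>\<omega>. inp h1 h2 h3 c m \<omega> a i) \<in> borel_measurable (noise n) \<and>
        integrable (noise n) (\<lambda>\<omega>. (inp h1 h2 h3 c m \<omega> a i)\<^sup>2)) \<and>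
     (\<forall>m\<in>msgs n R. err_event h1 h2 h3 n c m \<in> sets (noise n)) \<and>
     (\<forall>a\<in>{0..3}. avg_power h1 h2 h3 n R c a \<le> P)"

definition achievable :: "real \<Rightarrow> real \<Rightarrow> real \<Rightarrow> real \<Rightarrow> (nat \<Rightarrow> nat \<Rightarrow> real) \<Rightarrow> bool" where
  "achievable h1 h2 h3 P R \<longleftrightarrow>
     (\<forall>j k. R j k \<ge> 0) \<and>
     (\<exists>cs :: nat \<Rightarrow> code.
        (\<forall>n. valid_code h1 h2 h3 P n R (cs n)) \<and>
        (\<lambda>n. perr h1 h2 h3 n R (cs n)) \<longlonglongrightarrow> 0)"

definition sum_capacity :: "real \<Rightarrow> real \<Rightarrow> real \<Rightarrow> real \<Rightarrow> ereal" where
  "sum_capacity h1 h2 h3 P =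
     (SUP R \<in> {R. achievable h1 h2 h3 P R}. ereal (\<Sum>(j,k)\<in>pairs. R j k))"

end

theory Submission
  imports Defs
begin

text \<open>
  The six rates split into two triples of the form \<open>R_kj + R_lj + R_kl\<close>. A receiver that sees the
  outputs of users \<open>j\<close> and \<open>l\<close> and is told the messages of user \<open>j\<close> and \<open>m_lk\<close> decodes all three
  messages of a triple: first \<open>m_kj\<close> and \<open>m_lj\<close> as user \<open>j\<close>, then, knowing both messages of user \<open>l\<close>,
  also \<open>m_kl\<close> as user \<open>l\<close>. The broadcast bound uses just these two outputs; the multiple-access bound
  adds the relay output, from which the contribution of user \<open>j\<close> can be subtracted.

  Instead of mutual information, the converse uses a change of measure on the noise space. For fixed
  messages, the observations are a triangular shear of the noise. Shears preserve Lebesgue measure, so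
  the law of the observations has an explicit likelihood ratio \<open>exp L\<close> with respect to a product of
  Gaussians that does not depend on the messages. Since the decoding regions are disjoint, the sum
  over the messages of \<open>E[exp (-L); correct]\<close> is at most 1 for each value of the side information,
  and Jensen's inequality gives \<open>log M \<le> (E L + 1) / p - log p\<close> for success probability \<open>p\<close>. With the
  variances of the reference Gaussians taken at full power \<open>P\<close>, \<open>E L\<close> is bounded by an affine function
  of the transmit powers, hence by \<open>n\<close> times the claimed capacity.
\<close>

section \<open>Causal shears\<close>

abbreviation borel_pi :: "'i set \<Rightarrow> ('i \<Rightarrow> real) measure" where
  "borel_pi I \<equiv> PiM I (\<lambda>_. borel)"

definition shear :: "'i set \<Rightarrow> ('i \<Rightarrow> ('i \<Rightarrow> real) \<Rightarrow> real) \<Rightarrow> ('i \<Rightarrow> real) \<Rightarrow> 'i \<Rightarrow> real" where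
  "shear I s w = (\<lambda>t\<in>I. s t w + w t)"

definition causal :: "('i \<Rightarrow> nat) \<Rightarrow> 'i set \<Rightarrow> ('i \<Rightarrow> ('i \<Rightarrow> real) \<Rightarrow> real) \<Rightarrow> bool" where
  "causal r I s \<longleftrightarrow> (\<forall>t\<in>I. s t \<in> borel_measurable (borel_pi I) \<and>
     (\<forall>w w'. (\<forall>u\<in>I. r u < r t \<longrightarrow> w u = w' u) \<longrightarrow> s t w = s t w'))"

lemma causal_measurable: "causal r I s \<Longrightarrow> t \<in> I \<Longrightarrow> s t \<in> borel_measurable (borel_pi I)"
  by (simp add: causal_def)

lemma causal_cong:
  "causal r I s \<Longrightarrow> t \<in> I \<Longrightarrow> (\<And>u. u \<in> I \<Longrightarrow> r u < r t \<Longrightarrow> w u = w' u) \<Longrightarrow> s t w = s t w'"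
  unfolding causal_def by metis

lemma causal_fun_upd: "causal r I s \<Longrightarrow> t \<in> I \<Longrightarrow> \<not> r u < r t \<Longrightarrow> s t (w(u := z)) = s t w"
  by (rule causal_cong[of r I s t]) auto

lemma shear_extensional: "shear I s w \<in> extensional I"
  by (simp add: shear_def)

lemma measurable_shear:
  assumes "causal r I s"
  shows "shear I s \<in> measurable (borel_pi I) (borel_pi I)"
  unfolding shear_def
  by (intro measurable_restrict borel_measurable_add causal_measurable[OF assms]
      measurable_component_singleton)

lemma inj_on_shear:
  assumes "causal r I s"
  shows "inj_on (shear I s) (extensional I)"
proof (rule inj_onI)
  fix w w' assume ext: "w \<in> extensional I" "w' \<in> extensional I"
    and eq: "shear I s w = shear I s w'"
  have "w t = w' t" if "t \<in> I" for t
    using that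
  proof (induction "r t" arbitrary: t rule: less_induct)
    case less
    have "s t w = s t w'"
      using less by (intro causal_cong[OF assms]) auto
    then show ?case
      using fun_cong[OF eq, of t] \<open>t \<in> I\<close> by (simp add: shear_def)
  qed
  then show "w = w'"
    using ext by (rule extensionalityI[rotated 2])
qed

subsection \<open>The inverse of a shear\<close>

text \<open>The iteration \<open>w \<mapsto> y - s w\<close> computes the preimage of \<open>y\<close>: after \<open>n\<close> rounds all coordinates
  of rank below \<open>n\<close> have their final value.\<close>
definition unshear ::
  "('i \<Rightarrow> nat) \<Rightarrow> 'i set \<Rightarrow> ('i \<Rightarrow> ('i \<Rightarrow> real) \<Rightarrow> real) \<Rightarrow> ('i \<Rightarrow> real) \<Rightarrow> 'i \<Rightarrow> real" where
  "unshear r I s y = ((\<lambda>w. \<lambda>t\<in>I. y t - s t w) ^^ Suc (Max (r ` I))) y"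

lemma unshear_extensional: "unshear r I s y \<in> extensional I"
  by (simp add: unshear_def)

lemma measurable_unshear:
  assumes "causal r I s"
  shows "unshear r I s \<in> measurable (borel_pi I) (borel_pi I)"
proof -
  have "(\<lambda>y. ((\<lambda>w. \<lambda>t\<in>I. y t - s t w) ^^ n) y) \<in> measurable (borel_pi I) (borel_pi I)" for n
  proof (induction n)
    case (Suc n)
    show ?case
      unfolding funpow.simps o_apply
    proof (intro measurable_restrict borel_measurable_diff measurable_component_singleton)
      fix t assume "t \<in> I"
      with Suc show "(\<lambda>y. s t (((\<lambda>w. \<lambda>t\<in>I. y t - s t w) ^^ n) y)) \<in> borel_measurable (borel_pi I)"
        by (rule measurable_compose[OF _ causal_measurable[OF assms]])
    qed
  qed simp
  then show ?thesis
    unfolding unshear_def[abs_def] .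
qed

lemma shear_unshear:
  assumes "finite I" and causal_s: "causal r I s" and y_ext: "y \<in> extensional I"
  shows "shear I s (unshear r I s y) = y"
proof (rule extensionalityI[OF shear_extensional y_ext])
  define T where "T w = (\<lambda>t\<in>I. y t - s t w)" for w
  have T_apply: "(T ^^ Suc n) w t = y t - s t ((T ^^ n) w)" if "t \<in> I" for n w t
    using that by (simp add: T_def[of "(T ^^ n) w"])
  have stable: "(T ^^ n) y t = (T ^^ Suc n) y t" if "t \<in> I" "r t < n" for n t
    using that
  proof (induction n arbitrary: t)
    case (Suc n)
    have "s t ((T ^^ n) y) = s t ((T ^^ Suc n) y)"
      using Suc by (intro causal_cong[OF causal_s]) auto
    then show ?case
      using \<open>t \<in> I\<close> by (simp only: T_apply)
  qed simp
  fix t assume t: "t \<in> I"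
  define N where "N = Suc (Max (r ` I))"
  have "(T ^^ N) y t = y t - s t ((T ^^ N) y)"
    using stable[OF t, of N] assms(1) t unfolding T_apply[OF t] by (simp add: N_def less_Suc_eq_le)
  then show "shear I s (unshear r I s y) t = y t"
    using t by (simp add: shear_def unshear_def T_def[abs_def] N_def)
qed

lemma unshear_shear:
  assumes "finite I" "causal r I s" "w \<in> extensional I"
  shows "unshear r I s (shear I s w) = w"
  using inj_onD[OF inj_on_shear[OF assms(2)] _ unshear_extensional assms(3)]
    shear_unshear[OF assms(1,2) shear_extensional] by blast

lemma sets_shear_image:
  assumes "finite I" "causal r I s" and A_sets: "A \<in> sets (borel_pi I)"
  shows "shear I s ` A \<in> sets (borel_pi I)"
proof -
  have "A \<subseteq> extensional I"
    using sets.sets_into_space[OF A_sets] by (simp add: space_PiM PiE_def)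
  have "shear I s ` A = unshear r I s -` A \<inter> extensional I"
  proof (intro equalityI subsetI)
    fix y assume "y \<in> shear I s ` A"
    then show "y \<in> unshear r I s -` A \<inter> extensional I"
      using \<open>A \<subseteq> extensional I\<close> by (auto simp: unshear_shear[OF assms(1,2)] shear_extensional)
  next
    fix y assume "y \<in> unshear r I s -` A \<inter> extensional I"
    then show "y \<in> shear I s ` A"
      by (intro image_eqI[of _ _ "unshear r I s y"]) (auto simp: shear_unshear[OF assms(1,2)])
  qed
  then show ?thesis
    using measurable_sets[OF measurable_unshear[OF assms(2)] A_sets] by (simp add: space_PiM PiE_def)
qed

subsection \<open>Shears preserve Lebesgue measure\<close>

lemma measurable_PiM_remove:
  assumes "f \<in> borel_measurable (borel_pi (insert t I))" and "\<And>w z. f (w(t := z)) = f w"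
  shows "f \<in> borel_measurable (borel_pi I)"
proof -
  have "(\<lambda>w. w(t := 0)) \<in> measurable (borel_pi I) (borel_pi (insert t I))"
    by (rule measurable_fun_upd[where J=I]) auto
  from measurable_compose[OF this assms(1)] show ?thesis
    by (simp add: assms(2))
qed

lemma causal_remove:
  assumes causal_s: "causal r (insert t I) s" and last: "\<And>u. u \<in> I \<Longrightarrow> r u \<le> r t"
  shows "causal r I s"
  unfolding causal_def
proof (intro ballI conjI allI impI)
  fix u assume u: "u \<in> I"
  then have "\<not> r t < r u"
    using last by (simp add: not_less)
  with u show "s u \<in> borel_measurable (borel_pi I)"
    by (intro measurable_PiM_remove[OF causal_measurable[OF causal_s]] causal_fun_upd[OF causal_s]) auto
  show "s u w = s u w'" if "\<forall>v\<in>I. r v < r u \<longrightarrow> w v = w' v" for w w'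
    using that u \<open>\<not> r t < r u\<close> by (intro causal_cong[OF causal_s]) auto
qed

lemma shear_insert:
  assumes causal_s: "causal r (insert t I) s" and "\<And>u. u \<in> I \<Longrightarrow> r u \<le> r t" and "t \<notin> I"
  shows "shear (insert t I) s (w(t := z)) = (shear I s w)(t := s t w + z)"
proof
  fix u
  have "s u (w(t := z)) = s u w" if "u \<in> insert t I"
    using that assms(2)[of u] by (intro causal_fun_upd[OF causal_s]) auto
  then show "shear (insert t I) s (w(t := z)) u = ((shear I s w)(t := s t w + z)) u"
    using assms(3) by (auto simp: shear_def)
qed

lemma nn_integral_lborel_translation:
  fixes f :: "real \<Rightarrow> ennreal"
  assumes "f \<in> borel_measurable borel"
  shows "(\<integral>\<^sup>+z. f (a + z) \<partial>lborel) = (\<integral>\<^sup>+z. f z \<partial>lborel)"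
  using nn_integral_real_affine[OF assms, of 1 a] by simp

lemma sets_PiM_lborel: "sets (PiM I (\<lambda>_. lborel :: real measure)) = sets (borel_pi I)"
  by (rule sets_PiM_cong) auto

lemma nn_integral_shear_insert:
  assumes "finite I" and "t \<notin> I" and causal_s: "causal r (insert t I) s"
    and last: "\<And>u. u \<in> I \<Longrightarrow> r u \<le> r t"
    and F_meas [measurable]: "F \<in> borel_measurable (borel_pi (insert t I))"
  shows "(\<integral>\<^sup>+w. F (shear (insert t I) s w) \<partial>PiM (insert t I) (\<lambda>_. lborel))
    = (\<integral>\<^sup>+x. \<integral>\<^sup>+z. F ((shear I s x)(t := z)) \<partial>lborel \<partial>PiM I (\<lambda>_. lborel))"
proof -
  interpret product_sigma_finite "\<lambda>_. lborel :: real measure" ..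
  note [measurable_cong] = sets_PiM_lborel
  note [measurable] = measurable_shear[OF causal_s]
  have "(\<integral>\<^sup>+w. F (shear (insert t I) s w) \<partial>PiM (insert t I) (\<lambda>_. lborel))
    = (\<integral>\<^sup>+x. \<integral>\<^sup>+z. F (shear (insert t I) s (x(t := z))) \<partial>lborel \<partial>PiM I (\<lambda>_. lborel))"
    by (rule product_nn_integral_insert[OF assms(1,2)]) measurable
  also have "\<dots> = (\<integral>\<^sup>+x. \<integral>\<^sup>+z. F ((shear I s x)(t := s t x + z)) \<partial>lborel \<partial>PiM I (\<lambda>_. lborel))"
    by (simp only: shear_insert[OF causal_s last assms(2)])
  also have "\<dots> = (\<integral>\<^sup>+x. \<integral>\<^sup>+z. F ((shear I s x)(t := z)) \<partial>lborel \<partial>PiM I (\<lambda>_. lborel))"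
  proof (rule nn_integral_cong)
    fix x
    have "shear I s x \<in> space (borel_pi I)"
      by (simp add: space_PiM PiE_def shear_extensional)
    then have "(\<lambda>z. F ((shear I s x)(t := z))) \<in> borel_measurable borel"
      by measurable
    then show "(\<integral>\<^sup>+z. F ((shear I s x)(t := s t x + z)) \<partial>lborel)
      = (\<integral>\<^sup>+z. F ((shear I s x)(t := z)) \<partial>lborel)"
      by (rule nn_integral_lborel_translation)
  qed
  finally show ?thesis .
qed

lemma nn_integral_shear_lborel:
  assumes "finite I" and "causal r I s" and "F \<in> borel_measurable (borel_pi I)"
  shows "(\<integral>\<^sup>+w. F (shear I s w) \<partial>PiM I (\<lambda>_. lborel)) = (\<integral>\<^sup>+w. F w \<partial>PiM I (\<lambda>_. lborel))"
  using assms
proof (induction I arbitrary: F rule: finite_ranking_induct[where f=r])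
  case empty
  then show ?case
    by (simp add: PiM_empty shear_def nn_integral_count_space_finite)
next
  case (insert t I)
  show ?case
  proof (cases "t \<in> I")
    case True
    then show ?thesis
      using insert by (simp add: insert_absorb)
  next
    case False
    interpret product_sigma_finite "\<lambda>_. lborel :: real measure" ..
    note [measurable_cong] = sets_PiM_lborel
    note causal_s = insert.prems(1) and F_meas [measurable] = insert.prems(2)
    have [measurable]: "(\<lambda>(x, z). F (x(t := z))) \<in> borel_measurable (borel_pi I \<Otimes>\<^sub>M borel)"
      unfolding split_beta'
      by (rule measurable_compose[OF _ F_meas], rule measurable_fun_upd[where J=I]) auto
    have "(\<integral>\<^sup>+w. F (shear (insert t I) s w) \<partial>PiM (insert t I) (\<lambda>_. lborel))
      = (\<integral>\<^sup>+x. \<integral>\<^sup>+z. F ((shear I s x)(t := z)) \<partial>lborel \<partial>PiM I (\<lambda>_. lborel))"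
      by (rule nn_integral_shear_insert[OF insert.hyps(1) False causal_s insert.hyps(2) F_meas])
    also have "\<dots> = (\<integral>\<^sup>+x. \<integral>\<^sup>+z. F (x(t := z)) \<partial>lborel \<partial>PiM I (\<lambda>_. lborel))"
      by (rule insert.IH[OF causal_remove[OF causal_s insert.hyps(2)],
            of "\<lambda>x. \<integral>\<^sup>+z. F (x(t := z)) \<partial>lborel"]) measurable
    also have "\<dots> = (\<integral>\<^sup>+w. F w \<partial>PiM (insert t I) (\<lambda>_. lborel))"
      by (rule product_nn_integral_insert[OF insert.hyps(1) False, symmetric]) measurable
    finally show ?thesis .
  qed
qed

section \<open>Likelihood ratios of sheared Gaussian noise\<close>

lemma sets_PiM_density_lborel: "sets (PiM I (\<lambda>t. density lborel (f t))) = sets (borel_pi I)"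
  by (rule sets_PiM_cong) auto

lemma PiM_density:
  assumes finite_I: "finite I" and f_meas: "\<And>i. f i \<in> borel_measurable (M i)"
    and M_sigma_finite: "\<And>i. sigma_finite_measure (M i)"
    and density_sigma_finite: "\<And>i. sigma_finite_measure (density (M i) (f i))"
  shows "PiM I (\<lambda>i. density (M i) (f i)) = density (PiM I M) (\<lambda>x. \<Prod>i\<in>I. f i (x i))"
proof -
  interpret M: product_sigma_finite M
    by (simp add: product_sigma_finite_def M_sigma_finite)
  interpret D: product_sigma_finite "\<lambda>i. density (M i) (f i)"
    by (simp add: product_sigma_finite_def density_sigma_finite)
  note f_meas [measurable]
  show ?thesis
  proof (rule D.PiM_eqI[OF finite_I, symmetric])
    show "sets (density (PiM I M) (\<lambda>x. \<Prod>i\<in>I. f i (x i))) = sets (PiM I (\<lambda>i. density (M i) (f i)))"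
      by (simp add: sets_PiM_cong[OF refl, of I M "\<lambda>i. density (M i) (f i)"])
  next
    fix A assume "\<And>i. i \<in> I \<Longrightarrow> A i \<in> sets (density (M i) (f i))"
    then have A [measurable]: "i \<in> I \<Longrightarrow> A i \<in> sets (M i)" for i
      by simp
    have "emeasure (density (PiM I M) (\<lambda>x. \<Prod>i\<in>I. f i (x i))) (PiE I A)
      = (\<integral>\<^sup>+x. (\<Prod>i\<in>I. f i (x i)) * indicator (PiE I A) x \<partial>PiM I M)"
      using finite_I A
      by (intro emeasure_density borel_measurable_prod_ennreal sets_PiM_I_finite) measurable
    also have "\<dots> = (\<integral>\<^sup>+x. (\<Prod>i\<in>I. f i (x i) * indicator (A i) (x i)) \<partial>PiM I M)"
    proof (intro nn_integral_cong)
      fix x assume "x \<in> space (PiM I M)"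
      then have "indicator (PiE I A) x = (\<Prod>i\<in>I. indicator (A i) (x i) :: ennreal)"
        using finite_I by (auto simp: indicator_def PiE_iff space_PiM)
      then show "(\<Prod>i\<in>I. f i (x i)) * indicator (PiE I A) x = (\<Prod>i\<in>I. f i (x i) * indicator (A i) (x i))"
        by (simp add: prod.distrib)
    qed
    also have "\<dots> = (\<Prod>i\<in>I. \<integral>\<^sup>+x. f i x * indicator (A i) x \<partial>M i)"
      using finite_I by (rule M.product_nn_integral_prod) (use A in measurable)
    also have "\<dots> = (\<Prod>i\<in>I. emeasure (density (M i) (f i)) (A i))"
      using A f_meas by (simp add: emeasure_density)
    finally show "emeasure (density (PiM I M) (\<lambda>x. \<Prod>i\<in>I. f i (x i))) (PiE I A)
      = (\<Prod>i\<in>I. emeasure (density (M i) (f i)) (A i))" .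
  qed
qed

abbreviation gaussian_pi :: "('i \<Rightarrow> real) \<Rightarrow> 'i set \<Rightarrow> ('i \<Rightarrow> real) measure" where
  "gaussian_pi v I \<equiv> PiM I (\<lambda>t. density lborel (normal_density 0 (sqrt (v t))))"

abbreviation std_gaussian_pi :: "'i set \<Rightarrow> ('i \<Rightarrow> real) measure" where
  "std_gaussian_pi I \<equiv> PiM I (\<lambda>_. density lborel std_normal_density)"

lemma measurable_std_gaussian_pi: "measurable (std_gaussian_pi I) N = measurable (borel_pi I) N"
  by (rule measurable_cong_sets[OF sets_PiM_density_lborel refl])

lemma prob_space_gaussian_pi: "(\<And>t. v t > 0) \<Longrightarrow> prob_space (gaussian_pi v I)"
  by (intro prob_space_PiM prob_space_normal_density) simp

lemma prob_space_std_gaussian_pi: "prob_space (std_gaussian_pi I)"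
  using prob_space_gaussian_pi[of "\<lambda>_. 1"] by simp

lemma gaussian_pi_eq_density:
  assumes "finite I" and "\<And>t. v t > 0"
  shows "gaussian_pi v I
    = density (PiM I (\<lambda>_. lborel)) (\<lambda>w. \<Prod>t\<in>I. ennreal (normal_density 0 (sqrt (v t)) (w t)))"
  using assms by (intro PiM_density lborel.sigma_finite_measure_axioms
      prob_space_imp_sigma_finite prob_space_normal_density) auto

text \<open>Log-likelihood ratio of the sheared noise against independent centred Gaussians of
  variances \<open>v\<close>, as a function of the noise.\<close>
definition llr :: "('i \<Rightarrow> real) \<Rightarrow> 'i set \<Rightarrow> ('i \<Rightarrow> ('i \<Rightarrow> real) \<Rightarrow> real) \<Rightarrow> ('i \<Rightarrow> real) \<Rightarrow> real" where
  "llr v I s w = (\<Sum>t\<in>I. (ln (v t) + (s t w + w t)\<^sup>2 / v t - (w t)\<^sup>2) / 2)"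

lemma measurable_llr:
  assumes "causal r I s"
  shows "llr v I s \<in> borel_measurable (borel_pi I)"
proof -
  note [measurable] = causal_measurable[OF assms]
  show ?thesis
    unfolding llr_def[abs_def] by measurable
qed

lemma normal_density_eq_std_normal_density_exp:
  assumes "v > 0"
  shows "normal_density 0 (sqrt v) y = std_normal_density z * exp (- ((ln v + y\<^sup>2 / v - z\<^sup>2) / 2))"
proof -
  have "- ((ln v + y\<^sup>2 / v - z\<^sup>2) / 2) = z\<^sup>2 / 2 - y\<^sup>2 / (2 * v) - ln (sqrt v)"
    using assms by (simp add: ln_sqrt field_simps)
  then have "exp (- ((ln v + y\<^sup>2 / v - z\<^sup>2) / 2)) = exp (z\<^sup>2 / 2) * exp (- (y\<^sup>2 / (2 * v))) / sqrt v"
    using assms by (simp only: exp_diff exp_ln real_sqrt_gt_zero) (simp add: exp_minus field_simps)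
  then show ?thesis
    using assms by (simp add: normal_density_def real_sqrt_mult exp_minus field_simps)
qed

lemma prod_normal_density_shear:
  assumes "finite I" and "\<And>t. v t > 0"
  shows "(\<Prod>t\<in>I. ennreal (normal_density 0 (sqrt (v t)) (shear I s w t)))
    = (\<Prod>t\<in>I. ennreal (std_normal_density (w t))) * ennreal (exp (- llr v I s w))"
proof -
  have "(\<Prod>t\<in>I. normal_density 0 (sqrt (v t)) (shear I s w t))
    = (\<Prod>t\<in>I. std_normal_density (w t) * exp (- ((ln (v t) + (s t w + w t)\<^sup>2 / v t - (w t)\<^sup>2) / 2)))"
    by (intro prod.cong refl) (simp add: shear_def normal_density_eq_std_normal_density_exp[OF assms(2)])
  also have "\<dots> = (\<Prod>t\<in>I. std_normal_density (w t)) * exp (- llr v I s w)"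
    using assms(1) by (simp add: prod.distrib llr_def exp_sum sum_negf[symmetric])
  finally show ?thesis
    by (simp add: prod_ennreal prod_nonneg ennreal_mult)
qed

lemma emeasure_gaussian_pi_shear_image:
  assumes finite_I: "finite I" and causal_s: "causal r I s"
    and v_pos: "\<And>t. v t > 0" and A_sets: "A \<in> sets (borel_pi I)"
  shows "emeasure (gaussian_pi v I) (shear I s ` A)
    = (\<integral>\<^sup>+w. ennreal (exp (- llr v I s w)) * indicator A w \<partial>std_gaussian_pi I)"
proof -
  let ?L = "PiM I (\<lambda>_. lborel :: real measure)"
  let ?f = "\<lambda>w. \<Prod>t\<in>I. ennreal (normal_density 0 (sqrt (v t)) (w t))"
  let ?B = "shear I s ` A"
  note [measurable_cong] = sets_PiM_lborel
  note [measurable] = A_sets sets_shear_image[OF finite_I causal_s A_sets] measurable_llr[OF causal_s]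
  have std_eq: "std_gaussian_pi I = density ?L (\<lambda>w. \<Prod>t\<in>I. ennreal (std_normal_density (w t)))"
    using gaussian_pi_eq_density[OF finite_I, of "\<lambda>_. 1"] by simp
  have indicator_image: "indicator ?B (shear I s w) = (indicator A w :: ennreal)" if "w \<in> space ?L" for w
    using inj_on_image_mem_iff[OF inj_on_shear[OF causal_s], of w A] that sets.sets_into_space[OF A_sets]
    by (simp add: indicator_def space_PiM PiE_def)
  have "emeasure (gaussian_pi v I) ?B = (\<integral>\<^sup>+w. ?f w * indicator ?B w \<partial>?L)"
    unfolding gaussian_pi_eq_density[OF finite_I v_pos] by (rule emeasure_density) measurable
  also have "\<dots> = (\<integral>\<^sup>+w. ?f (shear I s w) * indicator ?B (shear I s w) \<partial>?L)"
    by (rule nn_integral_shear_lborel[OF finite_I causal_s, symmetric]) measurable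
  also have "\<dots> = (\<integral>\<^sup>+w. (\<Prod>t\<in>I. ennreal (std_normal_density (w t)))
      * (ennreal (exp (- llr v I s w)) * indicator A w) \<partial>?L)"
    by (intro nn_integral_cong)
      (simp add: prod_normal_density_shear[OF finite_I v_pos] indicator_image mult.assoc)
  also have "\<dots> = (\<integral>\<^sup>+w. ennreal (exp (- llr v I s w)) * indicator A w \<partial>std_gaussian_pi I)"
    unfolding std_eq by (rule nn_integral_density[symmetric]) measurable
  finally show ?thesis .
qed

lemma integrable_exp_minus_llr:
  assumes finite_I: "finite I" and causal_s: "causal r I s" and v_pos: "\<And>t. v t > 0"
  shows "integrable (std_gaussian_pi I) (\<lambda>w. exp (- llr v I s w))"
proof (rule integrableI_nonneg)
  let ?S = "space (borel_pi I) :: ('a \<Rightarrow> real) set"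
  interpret Q: prob_space "gaussian_pi v I"
    by (rule prob_space_gaussian_pi[OF v_pos])
  show "(\<lambda>w. exp (- llr v I s w)) \<in> borel_measurable (std_gaussian_pi I)"
    unfolding measurable_std_gaussian_pi using measurable_llr[OF causal_s] by measurable
  have "(\<integral>\<^sup>+w. ennreal (exp (- llr v I s w)) \<partial>std_gaussian_pi I)
    = (\<integral>\<^sup>+w. ennreal (exp (- llr v I s w)) * indicator ?S w \<partial>std_gaussian_pi I)"
    by (intro nn_integral_cong) (simp add: space_PiM)
  also have "\<dots> = emeasure (gaussian_pi v I) (shear I s ` ?S)"
    by (rule emeasure_gaussian_pi_shear_image[OF finite_I causal_s v_pos sets.top, symmetric])
  also have "\<dots> < \<infinity>"
    by (rule Q.emeasure_finite[THEN top.not_eq_extremum[THEN iffD1], folded infinity_ennreal_def])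
  finally show "(\<integral>\<^sup>+w. ennreal (exp (- llr v I s w)) \<partial>std_gaussian_pi I) < \<infinity>" .
qed simp

lemma set_integral_exp_minus_llr:
  assumes "finite I" and causal_s: "causal r I s" and "\<And>t. v t > 0" and A_sets: "A \<in> sets (borel_pi I)"
  shows "(LINT w:A|std_gaussian_pi I. exp (- llr v I s w)) = measure (gaussian_pi v I) (shear I s ` A)"
proof -
  have "(LINT w:A|std_gaussian_pi I. exp (- llr v I s w))
    = enn2real (\<integral>\<^sup>+w. ennreal (exp (- llr v I s w) * indicator A w) \<partial>std_gaussian_pi I)"
    unfolding set_lebesgue_integral_def using measurable_llr[OF causal_s] A_sets
    by (subst integral_eq_nn_integral) (auto simp: measurable_std_gaussian_pi mult.commute)
  also have "\<dots> = measure (gaussian_pi v I) (shear I s ` A)"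
    unfolding measure_def emeasure_gaussian_pi_shear_image[OF assms]
    by (intro arg_cong[where f=enn2real] nn_integral_cong) (auto simp: indicator_def)
  finally show ?thesis .
qed

lemma integral_exp_minus_llr_le_1:
  assumes "finite I" and causal_s: "causal r I s" and v_pos: "\<And>t. v t > 0"
  shows "(\<integral>w. exp (- llr v I s w) \<partial>std_gaussian_pi I) \<le> 1"
proof -
  have "(\<integral>w. exp (- llr v I s w) \<partial>std_gaussian_pi I)
    = (LINT w:space (borel_pi I)|std_gaussian_pi I. exp (- llr v I s w))"
    unfolding set_lebesgue_integral_def
    by (intro Bochner_Integration.integral_cong) (auto simp: space_PiM)
  also have "\<dots> \<le> 1"
    unfolding set_integral_exp_minus_llr[OF assms sets.top]
    by (rule prob_space.prob_le_1[OF prob_space_gaussian_pi[OF v_pos]])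
  finally show ?thesis .
qed

lemma sum_set_integral_exp_minus_llr_le_1:
  assumes finite_I: "finite I" and "finite M" and causal_s: "\<And>m. m \<in> M \<Longrightarrow> causal r I (s m)"
    and G_sets: "\<And>m. m \<in> M \<Longrightarrow> G m \<in> sets (borel_pi I)" and v_pos: "\<And>t. v t > 0"
    and disjoint: "disjoint_family_on (\<lambda>m. shear I (s m) ` G m) M"
  shows "(\<Sum>m\<in>M. LINT w:G m|std_gaussian_pi I. exp (- llr v I (s m) w)) \<le> 1"
proof -
  interpret Q: prob_space "gaussian_pi v I"
    by (rule prob_space_gaussian_pi[OF v_pos])
  have "(\<Sum>m\<in>M. LINT w:G m|std_gaussian_pi I. exp (- llr v I (s m) w))
    = (\<Sum>m\<in>M. Q.prob (shear I (s m) ` G m))"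
    by (intro sum.cong refl set_integral_exp_minus_llr[OF finite_I causal_s v_pos G_sets])
  also have "\<dots> = Q.prob (\<Union>m\<in>M. shear I (s m) ` G m)"
    using assms(2) sets_shear_image[OF finite_I causal_s G_sets] disjoint
    by (intro Q.finite_measure_finite_Union[symmetric]) (auto simp: sets_PiM_density_lborel)
  also have "\<dots> \<le> 1"
    by (rule Q.prob_le_1)
  finally show ?thesis .
qed

lemma sum_set_integral_exp_minus_llr_le_card:
  assumes finite_I: "finite I" and finite_M: "finite M" and causal_s: "\<And>m. m \<in> M \<Longrightarrow> causal r I (s m)"
    and G_sets: "\<And>m. m \<in> M \<Longrightarrow> G m \<in> sets (borel_pi I)" and v_pos: "\<And>t. v t > 0"
    and decodable: "\<And>m m' w w'. m \<in> M \<Longrightarrow> m' \<in> M \<Longrightarrow> genie m = genie m' \<Longrightarrow>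
      w \<in> G m \<Longrightarrow> w' \<in> G m' \<Longrightarrow> shear I (s m) w = shear I (s m') w' \<Longrightarrow> m = m'"
  shows "(\<Sum>m\<in>M. LINT w:G m|std_gaussian_pi I. exp (- llr v I (s m) w)) \<le> card (genie ` M)"
proof -
  let ?E = "\<lambda>m. LINT w:G m|std_gaussian_pi I. exp (- llr v I (s m) w)"
  have "(\<Sum>m\<in>M. ?E m) = (\<Sum>u\<in>genie ` M. \<Sum>m\<in>{m \<in> M. genie m = u}. ?E m)"
    by (rule sum.image_gen[OF finite_M])
  also have "\<dots> \<le> (\<Sum>u\<in>genie ` M. 1)"
    using finite_M
    by (intro sum_mono sum_set_integral_exp_minus_llr_le_1[OF finite_I _ causal_s G_sets v_pos])
      (auto simp: disjoint_family_on_def dest: decodable)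
  finally show ?thesis
    by simp
qed

lemma std_gaussian_pi_square_moment:
  assumes "t \<in> I"
  shows "integrable (std_gaussian_pi I) (\<lambda>w. (w t)\<^sup>2)" "(\<integral>w. (w t)\<^sup>2 \<partial>std_gaussian_pi I) = 1"
proof -
  let ?D = "density lborel std_normal_density"
  have distr: "distr (std_gaussian_pi I) ?D (\<lambda>w. w t) = ?D"
    using assms by (intro distr_PiM_component prob_space_normal_density) auto
  have component: "(\<lambda>w. w t) \<in> measurable (std_gaussian_pi I) ?D"
    using assms by simp
  have "integrable ?D (\<lambda>x. x\<^sup>2)"
    using integrable_std_normal_moment[of 2] by (subst integrable_density) auto
  then show "integrable (std_gaussian_pi I) (\<lambda>w. (w t)\<^sup>2)"
    using integrable_distr[OF component, of "\<lambda>x. x\<^sup>2"] by (simp add: distr)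
  have "(\<integral>x. x\<^sup>2 \<partial>?D) = 1"
    using integral_std_normal_moment_even[of 1] by (subst integral_density) auto
  then show "(\<integral>w. (w t)\<^sup>2 \<partial>std_gaussian_pi I) = 1"
    using integral_distr[OF component, of "\<lambda>x. x\<^sup>2"] by (simp add: distr)
qed

lemma integrable_mult_of_squares:
  fixes f g :: "'a \<Rightarrow> real"
  assumes "f \<in> borel_measurable M" "g \<in> borel_measurable M"
    and "integrable M (\<lambda>x. (f x)\<^sup>2)" "integrable M (\<lambda>x. (g x)\<^sup>2)"
  shows "integrable M (\<lambda>x. f x * g x)"
proof (rule Bochner_Integration.integrable_bound)
  show "integrable M (\<lambda>x. (f x)\<^sup>2 + (g x)\<^sup>2)" "(\<lambda>x. f x * g x) \<in> borel_measurable M"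
    using assms by simp_all
  have "\<bar>a * b\<bar> \<le> a\<^sup>2 + b\<^sup>2" for a b :: real
    using sum_squares_bound[of "\<bar>a\<bar>" "\<bar>b\<bar>"] abs_ge_zero[of "a * b"]
    unfolding abs_mult power2_abs by linarith
  then show "AE x in M. norm (f x * g x) \<le> norm ((f x)\<^sup>2 + (g x)\<^sup>2)"
    by simp
qed

lemma std_gaussian_pi_uncorrelated:
  assumes I: "finite I" "t \<in> I"
    and X_square_int: "X \<in> borel_measurable (std_gaussian_pi I)"
      "integrable (std_gaussian_pi I) (\<lambda>w. (X w)\<^sup>2)"
    and indep: "\<And>w z. X (w(t := z)) = X w"
  shows "integrable (std_gaussian_pi I) (\<lambda>w. X w * w t)" "(\<integral>w. X w * w t \<partial>std_gaussian_pi I) = 0"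
proof -
  let ?D = "density lborel std_normal_density"
  show product_int: "integrable (std_gaussian_pi I) (\<lambda>w. X w * w t)"
    using assms by (intro integrable_mult_of_squares std_gaussian_pi_square_moment)
      (auto simp: measurable_std_gaussian_pi)
  interpret product_sigma_finite "\<lambda>_. ?D"
    using prob_space_imp_sigma_finite[OF prob_space_normal_density]
    by (simp add: product_sigma_finite_def)
  define J where "J = I - {t}"
  have I_eq: "I = insert t J" "t \<notin> J" "finite J"
    using I by (auto simp: J_def)
  have mean: "(\<integral>y. y \<partial>?D) = 0"
    using integral_std_normal_moment_odd[of 0] by (subst integral_density) auto
  have "(\<integral>w. X w * w t \<partial>std_gaussian_pi I)
    = (\<integral>w. (\<integral>y. X (w(t := y)) * (w(t := y)) t \<partial>?D) \<partial>std_gaussian_pi J)"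
    using product_integral_insert[OF I_eq(3,2), of "\<lambda>w. X w * w t"] product_int
    unfolding I_eq(1) by simp
  also have "\<dots> = 0"
    by (simp add: indep mean)
  finally show "(\<integral>w. X w * w t \<partial>std_gaussian_pi I) = 0" .
qed

lemma std_gaussian_pi_affine_square_moment:
  assumes I: "finite I" "t \<in> I"
    and X_square_int: "X \<in> borel_measurable (std_gaussian_pi I)"
      "integrable (std_gaussian_pi I) (\<lambda>w. (X w)\<^sup>2)"
    and indep: "\<And>w z. X (w(t := z)) = X w"
  shows "integrable (std_gaussian_pi I) (\<lambda>w. (a * X w + b * w t)\<^sup>2)"
    "(\<integral>w. (a * X w + b * w t)\<^sup>2 \<partial>std_gaussian_pi I) = a\<^sup>2 * (\<integral>w. (X w)\<^sup>2 \<partial>std_gaussian_pi I) + b\<^sup>2"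
proof -
  have expand: "(a * x + b * z)\<^sup>2 = a\<^sup>2 * x\<^sup>2 + 2 * a * b * (x * z) + b\<^sup>2 * z\<^sup>2" for x z
    by (simp add: power2_eq_square algebra_simps)
  note moments = std_gaussian_pi_uncorrelated[where X=X, OF assms]
    std_gaussian_pi_square_moment[OF I(2)] X_square_int(2)
  show "integrable (std_gaussian_pi I) (\<lambda>w. (a * X w + b * w t)\<^sup>2)"
    unfolding expand using moments by simp
  show "(\<integral>w. (a * X w + b * w t)\<^sup>2 \<partial>std_gaussian_pi I) = a\<^sup>2 * (\<integral>w. (X w)\<^sup>2 \<partial>std_gaussian_pi I) + b\<^sup>2"
    unfolding expand using moments by simp
qed

text \<open>Mean log-likelihood ratio of \<open>X + Z\<close>, with standard noise \<open>Z\<close> and \<open>E X\<^sup>2 = e\<close>, against a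
  centred Gaussian of variance \<open>v\<close>.\<close>
definition mean_llr :: "real \<Rightarrow> real \<Rightarrow> real" where
  "mean_llr v e = (ln v + (e + 1) / v - 1) / 2"

lemma mean_llr_eq: "v > 0 \<Longrightarrow> mean_llr v e = ln v / 2 + (e + 1 - v) / (2 * v)"
  by (simp add: mean_llr_def field_simps)

lemma mean_llr_affine:
  assumes "v > 0" and v: "v = \<alpha> * e' + \<beta> + 1"
  shows "mean_llr v (\<alpha> * e + \<beta>) = ln v / 2 + \<alpha> / (2 * v) * (e - e')"
proof -
  have "\<alpha> * e + \<beta> + 1 - v = \<alpha> * (e - e')"
    by (simp add: v algebra_simps)
  then show ?thesis
    by (simp add: mean_llr_eq[OF assms(1)])
qed

lemma expectation_llr:
  assumes finite_I: "finite I" and causal_s: "causal r I s"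
    and square_int: "\<And>t. t \<in> I \<Longrightarrow> integrable (std_gaussian_pi I) (\<lambda>w. (s t w)\<^sup>2)"
  shows "integrable (std_gaussian_pi I) (llr v I s)"
    "(\<integral>w. llr v I s w \<partial>std_gaussian_pi I) = (\<Sum>t\<in>I. mean_llr (v t) (\<integral>w. (s t w)\<^sup>2 \<partial>std_gaussian_pi I))"
proof -
  interpret prob_space "std_gaussian_pi I"
    by (rule prob_space_std_gaussian_pi)
  have sum_square: "integrable (std_gaussian_pi I) (\<lambda>w. (s t w + w t)\<^sup>2)"
    "(\<integral>w. (s t w + w t)\<^sup>2 \<partial>std_gaussian_pi I) = (\<integral>w. (s t w)\<^sup>2 \<partial>std_gaussian_pi I) + 1" if "t \<in> I" for t
    using std_gaussian_pi_affine_square_moment[where X="s t" and a=1 and b=1,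
        OF finite_I that _ square_int[OF that]]
    by (simp_all add: measurable_std_gaussian_pi causal_measurable[OF causal_s that]
        causal_fun_upd[OF causal_s that])
  note moments = sum_square std_gaussian_pi_square_moment
  show "integrable (std_gaussian_pi I) (llr v I s)"
    unfolding llr_def[abs_def] by (simp add: moments)
  show "(\<integral>w. llr v I s w \<partial>std_gaussian_pi I)
    = (\<Sum>t\<in>I. mean_llr (v t) (\<integral>w. (s t w)\<^sup>2 \<partial>std_gaussian_pi I))"
    unfolding llr_def by (simp add: moments mean_llr_def prob_space)
qed

section \<open>The change-of-measure converse\<close>

context prob_space
begin

text \<open>Jensen's inequality for \<open>exp\<close> on the event \<open>G\<close>, with the tangent taken at an arbitrary point
  so that the same tangent can be used for several events.\<close>
lemma set_integral_exp_minus_ge_tangent: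
  assumes G_event: "G \<in> events" and L_int: "integrable M L" and exp_int: "integrable M (\<lambda>w. exp (- L w))"
  shows "exp (- t) * ((1 + t) * prob G - (LINT w:G|M. L w)) \<le> (LINT w:G|M. exp (- L w))"
proof -
  have set_int: "set_integrable M G (\<lambda>_. 1 + t)" "set_integrable M G L"
      "set_integrable M G (\<lambda>w. exp (- L w))"
    unfolding set_integrable_def
    by (intro integrable_mult_indicator G_event L_int exp_int integrable_const)+
  have "exp (- t) * ((1 + t) * prob G - (LINT w:G|M. L w)) = exp (- t) * (LINT w:G|M. 1 + t - L w)"
    using G_event set_int by (simp add: set_integral_const mult.commute)
  also have "\<dots> = (LINT w:G|M. exp (- t) * (1 + t - L w))"
    by simp
  also have "\<dots> \<le> (LINT w:G|M. exp (- L w))"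
  proof (rule set_integral_mono)
    fix w
    have "exp (- t) * (1 + t - L w) \<le> exp (- t) * exp (t - L w)"
      using exp_ge_add_one_self[of "t - L w"] by (simp add: add_diff_eq)
    then show "exp (- t) * (1 + t - L w) \<le> exp (- L w)"
      by (simp flip: exp_add)
  qed (use set_int in auto)
  finally show ?thesis .
qed

lemma set_integral_le_expectation_add_exp_minus:
  fixes L :: "'a \<Rightarrow> real"
  assumes G_event: "G \<in> events" and L_int: "integrable M L" and exp_int: "integrable M (\<lambda>w. exp (- L w))"
  shows "(LINT w:G|M. L w) \<le> expectation L + expectation (\<lambda>w. exp (- L w))"
proof -
  have "(LINT w:G|M. L w) \<le> expectation (\<lambda>w. L w + exp (- L w))"
    unfolding set_lebesgue_integral_def
  proof (rule integral_mono)
    fix w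
    have "0 \<le> L w + exp (- L w)"
      using exp_ge_add_one_self[of "- L w"] by linarith
    then show "indicator G w *\<^sub>R L w \<le> L w + exp (- L w)"
      by (cases "w \<in> G") auto
  qed (intro integrable_mult_indicator Bochner_Integration.integrable_add G_event L_int exp_int)+
  then show ?thesis
    using L_int exp_int by simp
qed

end

text \<open>Bounds the logarithm of the number of messages decodable with success probability \<open>p\<close> when the
  log-likelihood ratio has mean at most \<open>B\<close>.\<close>
definition log_size_bound :: "real \<Rightarrow> real \<Rightarrow> real" where
  "log_size_bound B p = (B + 1) / p - ln p"

lemma (in prob_space) ln_le_log_size_bound:
  fixes L :: "'m \<Rightarrow> 'a \<Rightarrow> real" and B K p :: real
  assumes finite_nonempty: "finite I" "I \<noteq> {}"
    and G_events: "\<And>m. m \<in> I \<Longrightarrow> G m \<in> events" and L_int: "\<And>m. m \<in> I \<Longrightarrow> integrable M (L m)"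
    and exp_int: "\<And>m. m \<in> I \<Longrightarrow> integrable M (\<lambda>w. exp (- L m w))"
    and exp_le_1: "\<And>m. m \<in> I \<Longrightarrow> expectation (\<lambda>w. exp (- L m w)) \<le> 1"
    and K_pos: "K > 0" and sum_exp: "(\<Sum>m\<in>I. LINT w:G m|M. exp (- L m w)) \<le> card I / K"
    and mean: "(\<Sum>m\<in>I. expectation (L m)) \<le> card I * B"
    and sum_prob: "(\<Sum>m\<in>I. prob (G m)) = card I * p" and p_pos: "p > 0"
  shows "ln K \<le> log_size_bound B p"
proof -
  have card_pos: "real (card I) > 0"
    using finite_nonempty by (simp add: card_gt_0_iff)
  \<comment> \<open>the conditional mean of the log-likelihood ratio given success\<close>
  define t where "t = (\<Sum>m\<in>I. LINT w:G m|M. L m w) / (card I * p)"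
  have "(\<Sum>m\<in>I. LINT w:G m|M. L m w) \<le> (\<Sum>m\<in>I. expectation (L m) + 1)"
    using set_integral_le_expectation_add_exp_minus[OF G_events L_int exp_int] exp_le_1
    by (intro sum_mono) fastforce
  also have "\<dots> \<le> card I * (B + 1)"
    using mean by (simp add: sum.distrib algebra_simps)
  finally have t_le: "t \<le> (B + 1) / p"
    unfolding t_def using card_pos p_pos by (simp add: field_simps)
  have "exp (- t) * (card I * p)
    = exp (- t) * ((1 + t) * (\<Sum>m\<in>I. prob (G m)) - (\<Sum>m\<in>I. LINT w:G m|M. L m w))"
    using card_pos p_pos sum_prob by (simp add: t_def field_simps)
  also have "\<dots> = (\<Sum>m\<in>I. exp (- t) * ((1 + t) * prob (G m) - (LINT w:G m|M. L m w)))"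
    by (simp add: sum_distrib_left sum_subtractf right_diff_distrib)
  also have "\<dots> \<le> (\<Sum>m\<in>I. LINT w:G m|M. exp (- L m w))"
    by (intro sum_mono set_integral_exp_minus_ge_tangent G_events L_int exp_int)
  also note sum_exp
  finally have "K * p \<le> exp t"
    using card_pos K_pos by (simp add: exp_minus field_simps)
  then have "ln (K * p) \<le> t"
    using K_pos p_pos ln_le_cancel_iff[of "K * p" "exp t"] by simp
  with t_le show ?thesis
    using K_pos p_pos by (simp add: log_size_bound_def ln_mult)
qed

lemma shear_converse:
  fixes B K p :: real
  assumes finite_I: "finite I" and finite_nonempty: "finite M" "M \<noteq> {}"
    and causal_s: "\<And>m. m \<in> M \<Longrightarrow> causal r I (s m)"
    and square_int: "\<And>m t. m \<in> M \<Longrightarrow> t \<in> I \<Longrightarrow> integrable (std_gaussian_pi I) (\<lambda>w. (s m t w)\<^sup>2)"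
    and G_sets: "\<And>m. m \<in> M \<Longrightarrow> G m \<in> sets (std_gaussian_pi I)" and v_pos: "\<And>t. v t > 0"
    and decodable: "\<And>m m' w w'. m \<in> M \<Longrightarrow> m' \<in> M \<Longrightarrow> genie m = genie m' \<Longrightarrow>
      w \<in> G m \<Longrightarrow> w' \<in> G m' \<Longrightarrow> shear I (s m) w = shear I (s m') w' \<Longrightarrow> m = m'"
    and K_pos: "K > 0" and card_genie: "card (genie ` M) * K \<le> card M"
    and mean: "(\<Sum>m\<in>M. \<Sum>t\<in>I. mean_llr (v t) (\<integral>w. (s m t w)\<^sup>2 \<partial>std_gaussian_pi I)) \<le> card M * B"
    and sum_measure: "(\<Sum>m\<in>M. measure (std_gaussian_pi I) (G m)) = card M * p" and p_pos: "p > 0"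
  shows "ln K \<le> log_size_bound B p"
proof (rule prob_space.ln_le_log_size_bound[OF prob_space_std_gaussian_pi finite_nonempty G_sets
      _ _ _ K_pos _ _ sum_measure p_pos, where L="\<lambda>m. llr v I (s m)"])
  let ?N = "std_gaussian_pi I"
  show "integrable ?N (llr v I (s m))" if "m \<in> M" for m
    by (rule expectation_llr(1)[OF finite_I causal_s[OF that] square_int[OF that]])
  show "integrable ?N (\<lambda>w. exp (- llr v I (s m) w))" if "m \<in> M" for m
    by (rule integrable_exp_minus_llr[OF finite_I causal_s[OF that] v_pos])
  show "(\<integral>w. exp (- llr v I (s m) w) \<partial>?N) \<le> 1" if "m \<in> M" for m
    by (rule integral_exp_minus_llr_le_1[OF finite_I causal_s[OF that] v_pos])
  have "(\<Sum>m\<in>M. LINT w:G m|?N. exp (- llr v I (s m) w)) \<le> card (genie ` M)"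
    using G_sets
    by (intro sum_set_integral_exp_minus_llr_le_card[OF finite_I finite_nonempty(1) causal_s _ v_pos
          decodable]) (simp_all add: sets_PiM_density_lborel)
  also have "\<dots> \<le> card M / K"
    using K_pos card_genie by (simp add: field_simps)
  finally show "(\<Sum>m\<in>M. LINT w:G m|?N. exp (- llr v I (s m) w)) \<le> card M / K" .
  show "(\<Sum>m\<in>M. \<integral>w. llr v I (s m) w \<partial>?N) \<le> card M * B"
    using mean by (simp add: expectation_llr(2)[OF finite_I causal_s square_int])
qed

lemma log_size_bound_asymptotic:
  fixes x B :: real and \<epsilon> :: "nat \<Rightarrow> real"
  assumes "\<epsilon> \<longlonglongrightarrow> 0"
    and bound: "\<And>n. n > 0 \<Longrightarrow> \<epsilon> n < 1 \<Longrightarrow> real n * x \<le> log_size_bound (real n * B) (1 - \<epsilon> n)"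
  shows "x \<le> B"
proof (rule tendsto_le[OF sequentially_bot _ tendsto_const])
  let ?f = "\<lambda>n. (B + inverse (real n)) / (1 - \<epsilon> n) - ln (1 - \<epsilon> n) * inverse (real n)"
  have "(\<lambda>n. 1 - \<epsilon> n) \<longlonglongrightarrow> 1"
    using tendsto_diff[OF tendsto_const[of 1] assms(1)] by simp
  then have "?f \<longlonglongrightarrow> (B + 0) / 1 - ln 1 * 0"
    by (intro tendsto_intros lim_inverse_n) auto
  then show "?f \<longlonglongrightarrow> B"
    by simp
  have "eventually (\<lambda>n. \<epsilon> n < 1) sequentially"
    using assms(1) by (rule order_tendstoD) simp
  then show "eventually (\<lambda>n. x \<le> ?f n) sequentially"
    using eventually_gt_at_top[of 0]
  proof eventually_elim
    case (elim n)
    have "x \<le> log_size_bound (real n * B) (1 - \<epsilon> n) * inverse (real n)"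
      using bound[OF elim(2,1)] elim by (simp add: field_simps)
    also have "\<dots> = ?f n"
      using elim by (simp add: log_size_bound_def field_simps)
    finally show ?case .
  qed
qed

section \<open>Messages\<close>

lemma finite_pairs: "finite pairs"
  by (rule finite_subset[of _ "users \<times> users"]) (auto simp: pairs_def users_def)

lemma msgs_iff:
  "m \<in> msgs n R \<longleftrightarrow> (\<forall>(j, k)\<in>pairs. m j k \<in> {1..nmsg n (R j k)}) \<and> (\<forall>j k. (j, k) \<notin> pairs \<longrightarrow> m j k = 1)"
  unfolding msgs_def by (auto split: if_splits)

lemma msgs_row_eqI:
  assumes "m \<in> msgs n R" "m' \<in> msgs n R" and "\<And>b. (a, b) \<in> pairs \<Longrightarrow> m a b = m' a b"
  shows "m a = m' a"
proof
  show "m a b = m' a b" for b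
    using assms by (cases "(a, b) \<in> pairs") (auto simp: msgs_iff)
qed

lemma bij_betw_msgs:
  "bij_betw (\<lambda>m. restrict (case_prod m) pairs) (msgs n R) (PiE pairs (\<lambda>(j, k). {1..nmsg n (R j k)}))"
proof (rule bij_betw_byWitness[where f'="\<lambda>f j k. if (j, k) \<in> pairs then f (j, k) else 1"])
  show "\<forall>m\<in>msgs n R. (\<lambda>j k. if (j, k) \<in> pairs then restrict (case_prod m) pairs (j, k) else 1) = m"
    by (auto simp: msgs_iff fun_eq_iff)
  show "\<forall>f\<in>PiE pairs (\<lambda>(j, k). {1..nmsg n (R j k)}).
      restrict (\<lambda>(j, k). if (j, k) \<in> pairs then f (j, k) else 1) pairs = f"
    by (auto simp: fun_eq_iff PiE_def extensional_def restrict_def)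
  show "(\<lambda>m. restrict (case_prod m) pairs) ` msgs n R \<subseteq> PiE pairs (\<lambda>(j, k). {1..nmsg n (R j k)})"
    by (force simp: msgs_iff)
  show "(\<lambda>f j k. if (j, k) \<in> pairs then f (j, k) else 1) ` PiE pairs (\<lambda>(j, k). {1..nmsg n (R j k)})
      \<subseteq> msgs n R"
    by (auto simp: msgs_iff PiE_iff split_beta')
qed

lemma finite_msgs: "finite (msgs n R)"
  using bij_betw_finite[OF bij_betw_msgs] finite_pairs by (auto intro!: finite_PiE)

lemma card_msgs: "card (msgs n R) = (\<Prod>(j, k)\<in>pairs. nmsg n (R j k))"
  using bij_betw_same_card[OF bij_betw_msgs] finite_pairs
  by (simp add: card_PiE split_beta')

lemma powr_le_nmsg: "2 powr (real n * r) \<le> real (nmsg n r)"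
  unfolding nmsg_def by (simp add: of_nat_ceiling)

lemma nmsg_pos: "nmsg n r > 0"
  using powr_le_nmsg[of n r] powr_gt_zero[of 2 "real n * r"] by linarith

lemma card_msgs_pos: "card (msgs n R) > 0"
  unfolding card_msgs by (rule prod_pos) (auto simp: nmsg_pos)

lemma ln_nmsg_ge: "real n * r * ln 2 \<le> ln (real (nmsg n r))"
  using ln_mono[OF powr_le_nmsg[of n r]] by simp

section \<open>Codes for the Y-channel\<close>

lemma hist_cong:
  assumes "\<And>a i'. a \<in> {0..3} \<Longrightarrow> i' < i \<Longrightarrow> w (a, i') = w' (a, i')"
  shows "hist h1 h2 h3 c m w i = hist h1 h2 h3 c m w' i"
  using assms
proof (induction i)
  case (Suc i)
  have "hist h1 h2 h3 c m w i = hist h1 h2 h3 c m w' i"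
    by (rule Suc.IH) (auto intro: Suc.prems)
  moreover have "w (a, i) = w' (a, i)" if "a = 0 \<or> a \<in> users" for a
    using that by (intro Suc.prems) (auto simp: users_def)
  ultimately show ?case
    by (simp add: Let_def fun_eq_iff)
qed simp

lemma inp_cong:
  assumes "\<And>a i'. a \<in> {0..3} \<Longrightarrow> i' < i \<Longrightarrow> w (a, i') = w' (a, i')"
  shows "inp h1 h2 h3 c m w a i = inp h1 h2 h3 c m w' a i"
  unfolding inp_def using hist_cong[of i w w', OF assms] by simp

lemma hist_user:
  assumes "b \<in> users"
  shows "hist h1 h2 h3 c m w i b = map (\<lambda>i. gain h1 h2 h3 b * inp h1 h2 h3 c m w 0 i + w (b, i)) [0..<i]"
proof (induction i)
  case (Suc i)
  have "b \<noteq> 0"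
    using assms by (auto simp: users_def)
  then show ?case
    using assms Suc by (simp add: Let_def inp_def)
qed simp

locale y_channel_code =
  fixes h1 h2 h3 P :: real and n :: nat and R :: "nat \<Rightarrow> nat \<Rightarrow> real" and c :: code
  assumes valid: "valid_code h1 h2 h3 P n R c" and n_pos: "n > 0" and P_pos: "P > 0"
begin

abbreviation g :: "nat \<Rightarrow> real" where
  "g \<equiv> gain h1 h2 h3"

abbreviation \<epsilon> :: real where
  "\<epsilon> \<equiv> perr h1 h2 h3 n R c"

abbreviation I :: "(nat \<times> nat) set" where
  "I \<equiv> {0..3} \<times> {..<n}"

abbreviation N :: "(nat \<times> nat \<Rightarrow> real) measure" where
  "N \<equiv> std_gaussian_pi I"

abbreviation X :: "(nat \<Rightarrow> nat \<Rightarrow> nat) \<Rightarrow> (nat \<times> nat \<Rightarrow> real) \<Rightarrow> nat \<Rightarrow> nat \<Rightarrow> real" where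
  "X \<equiv> inp h1 h2 h3 c"

abbreviation Y :: "(nat \<Rightarrow> nat \<Rightarrow> nat) \<Rightarrow> (nat \<times> nat \<Rightarrow> real) \<Rightarrow> nat \<Rightarrow> nat \<Rightarrow> real list" where
  "Y m w a i \<equiv> hist h1 h2 h3 c m w i a"

definition energy :: "(nat \<Rightarrow> nat \<Rightarrow> nat) \<Rightarrow> nat \<Rightarrow> nat \<Rightarrow> real" where
  "energy m a i = (\<integral>w. (X m w a i)\<^sup>2 \<partial>N)"

definition correct :: "(nat \<Rightarrow> nat \<Rightarrow> nat) \<Rightarrow> (nat \<times> nat \<Rightarrow> real) set" where
  "correct m = space (noise n) - err_event h1 h2 h3 n c m"

lemma noise_eq: "noise n = N"
  by (simp add: noise_def)

lemma
  assumes "m \<in> msgs n R" "i < n" "a \<in> {0..3}"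
  shows inp_measurable: "(\<lambda>w. X m w a i) \<in> borel_measurable N"
    and inp_square_integrable: "integrable N (\<lambda>w. (X m w a i)\<^sup>2)"
  using valid assms unfolding valid_code_def noise_eq by auto

lemma correct_sets: "m \<in> msgs n R \<Longrightarrow> correct m \<in> sets N"
  using valid unfolding correct_def noise_eq valid_code_def by auto

lemma dec_correct: "w \<in> correct m \<Longrightarrow> (a, b) \<in> pairs \<Longrightarrow> dec c b (m b) (Y m w b n) a = m a b"
  by (auto simp: correct_def err_event_def)

lemma sum_measure_correct: "(\<Sum>m\<in>msgs n R. measure N (correct m)) = card (msgs n R) * (1 - \<epsilon>)"
proof -
  interpret prob_space N
    by (rule prob_space_std_gaussian_pi)
  have "(\<Sum>m\<in>msgs n R. measure N (correct m)) = (\<Sum>m\<in>msgs n R. 1 - measure N (err_event h1 h2 h3 n c m))"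
    using valid unfolding correct_def noise_eq valid_code_def by (intro sum.cong refl prob_compl) auto
  also have "\<dots> = card (msgs n R) * (1 - \<epsilon>)"
    using card_msgs_pos[of n R] by (simp add: perr_def noise_eq sum_subtractf field_simps)
  finally show ?thesis .
qed

lemma sum_excess_energy_le_0:
  assumes "a \<in> {0..3}"
  shows "(\<Sum>m\<in>msgs n R. \<Sum>i<n. energy m a i - P) \<le> 0"
proof -
  have "(\<Sum>m\<in>msgs n R. \<Sum>i<n. energy m a i) / (card (msgs n R) * real n) = avg_power h1 h2 h3 n R c a"
    unfolding avg_power_def noise_eq energy_def
    by (subst sum.swap) (simp add: sum_divide_distrib mult.commute)
  also have "\<dots> \<le> P"
    using valid assms by (simp add: valid_code_def)
  finally have "(\<Sum>m\<in>msgs n R. \<Sum>i<n. energy m a i) \<le> card (msgs n R) * real n * P"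
    using card_msgs_pos[of n R] n_pos by (simp add: field_simps)
  then show ?thesis
    by (simp add: sum_subtractf mult.assoc)
qed

lemma sum_weighted_excess_energy_le_0:
  assumes "\<And>a. \<kappa> a \<ge> 0"
  shows "(\<Sum>m\<in>msgs n R. \<Sum>i<n. \<Sum>a\<in>{0..3}. \<kappa> a * (energy m a i - P)) \<le> 0"
proof -
  have "(\<Sum>m\<in>msgs n R. \<Sum>i<n. \<Sum>a\<in>{0..3}. \<kappa> a * (energy m a i - P))
    = (\<Sum>m\<in>msgs n R. \<Sum>a\<in>{0..3}. \<kappa> a * (\<Sum>i<n. energy m a i - P))"
    by (subst sum.swap) (simp only: sum_distrib_left)
  also have "\<dots> = (\<Sum>a\<in>{0..3}. \<kappa> a * (\<Sum>m\<in>msgs n R. \<Sum>i<n. energy m a i - P))"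
    by (subst sum.swap) (simp only: sum_distrib_left)
  also have "\<dots> \<le> 0"
    by (intro sum_nonpos mult_nonneg_nonpos assms sum_excess_energy_le_0)
  finally show ?thesis .
qed

end

locale y_channel_triple = y_channel_code +
  fixes j k l :: nat
  assumes users_eq: "users = {j, k, l}"
begin

lemma users_distinct: "distinct [0, j, k, l]"
proof -
  have "card (set [j, k, l]) = length [j, k, l]"
    using users_eq by (simp flip: users_eq) (simp add: users_def)
  moreover have "0 \<notin> {j, k, l}"
    unfolding users_eq[symmetric] by (simp add: users_def)
  ultimately show ?thesis
    using card_distinct by fastforce
qed

lemma nodes_eq: "{0..3} = {0, j, k, l}"
  unfolding users_eq[symmetric] by (auto simp: users_def)

lemma pairs_eq: "pairs = {(j, k), (j, l), (l, k), (k, j), (l, j), (k, l)}"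
  using users_distinct unfolding pairs_def users_eq by auto

lemma sum_nodes: "(\<Sum>a\<in>{0..3}. f a) = f 0 + f j + f k + f l" for f :: "nat \<Rightarrow> real"
  using users_distinct by (simp add: nodes_eq add.assoc)

definition genie :: "(nat \<Rightarrow> nat \<Rightarrow> nat) \<Rightarrow> nat \<times> nat \<times> nat" where
  "genie m = (m j k, m j l, m l k)"

lemma card_genie: "card (genie ` msgs n R) \<le> nmsg n (R j k) * nmsg n (R j l) * nmsg n (R l k)"
proof -
  have "genie ` msgs n R \<subseteq> {1..nmsg n (R j k)} \<times> {1..nmsg n (R j l)} \<times> {1..nmsg n (R l k)}"
    by (auto simp: genie_def msgs_iff pairs_eq)
  from card_mono[OF _ this] show ?thesis
    by (simp add: mult.assoc)
qed

lemma card_genie_mult_le: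
  "card (genie ` msgs n R) * (nmsg n (R k j) * nmsg n (R l j) * nmsg n (R k l)) \<le> card (msgs n R)"
proof -
  have "card (msgs n R) = nmsg n (R j k) * nmsg n (R j l) * nmsg n (R l k)
      * (nmsg n (R k j) * nmsg n (R l j) * nmsg n (R k l))"
    using users_distinct unfolding card_msgs pairs_eq by (simp add: mult_ac)
  then show ?thesis
    using card_genie by simp
qed

lemma genie_row_eq: "m \<in> msgs n R \<Longrightarrow> m' \<in> msgs n R \<Longrightarrow> genie m = genie m' \<Longrightarrow> m j = m' j"
  by (rule msgs_row_eqI) (use users_distinct in \<open>auto simp: genie_def pairs_eq\<close>)

lemma decode_triple:
  assumes m: "m \<in> msgs n R" "m' \<in> msgs n R" and genie: "genie m = genie m'"
    and w: "w \<in> correct m" "w' \<in> correct m'"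
    and Y: "Y m w j n = Y m' w' j n" "Y m w l n = Y m' w' l n"
  shows "m = m'"
proof -
  note eqI = msgs_row_eqI[OF m] and dec = dec_correct[OF w(1)] dec_correct[OF w(2)]
  have row_j: "m j = m' j"
    by (rule genie_row_eq[OF m genie])
  have "m a j = m' a j" if "(a, j) \<in> pairs" for a
    using dec[OF that] Y(1) row_j by simp
  then have to_j: "m k j = m' k j" "m l j = m' l j"
    by (auto simp: pairs_eq)
  have row_l: "m l = m' l"
    using to_j genie users_distinct by (intro eqI) (auto simp: pairs_eq genie_def)
  have "m k l = m' k l"
    using dec[of k l] Y(2) row_l by (simp add: pairs_eq)
  then have row_k: "m k = m' k"
    using to_j users_distinct by (intro eqI) (auto simp: pairs_eq)
  show ?thesis
  proof
    have "m a = m' a" if "a \<notin> users" for a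
      using that by (intro eqI) (auto simp: pairs_def)
    then show "m a = m' a" for a
      using row_j row_k row_l unfolding users_eq by (cases "a \<in> {j, k, l}") auto
  qed
qed

text \<open>By the power constraints, the excess energies weighted by \<open>\<kappa>\<close> do not contribute on average.\<close>
lemma genie_aided_converse:
  fixes B :: real and \<kappa> v :: "nat \<Rightarrow> real"
  assumes \<epsilon>_less_1: "\<epsilon> < 1"
    and causal: "\<And>m. m \<in> msgs n R \<Longrightarrow> causal r I (s m)"
    and square_int: "\<And>m t. m \<in> msgs n R \<Longrightarrow> t \<in> I \<Longrightarrow> integrable N (\<lambda>w. (s m t w)\<^sup>2)"
    and v_pos: "\<And>a. v a > 0" and \<kappa>_nonneg: "\<And>a. \<kappa> a \<ge> 0"
    and mean: "\<And>m i. m \<in> msgs n R \<Longrightarrow> i < n \<Longrightarrow>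
      (\<Sum>a\<in>{0..3}. mean_llr (v a) (\<integral>w. (s m (a, i) w)\<^sup>2 \<partial>N)) \<le> B + (\<Sum>a\<in>{0..3}. \<kappa> a * (energy m a i - P))"
    and recover: "\<And>m m' w w'. m j = m' j \<Longrightarrow> shear I (s m) w = shear I (s m') w' \<Longrightarrow>
      Y m w j n = Y m' w' j n \<and> Y m w l n = Y m' w' l n"
  shows "real n * (R k j + R l j + R k l) * ln 2 \<le> log_size_bound (real n * B) (1 - \<epsilon>)"
proof -
  let ?M = "msgs n R"
  let ?K = "real (nmsg n (R k j) * nmsg n (R l j) * nmsg n (R k l))"
  have rate: "real n * (R k j + R l j + R k l) * ln 2 \<le> ln ?K"
    using ln_nmsg_ge[of n "R k j"] ln_nmsg_ge[of n "R l j"] ln_nmsg_ge[of n "R k l"]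
    by (simp add: ln_mult nmsg_pos algebra_simps)
  have "(\<Sum>m\<in>?M. \<Sum>t\<in>I. mean_llr (v (fst t)) (\<integral>w. (s m t w)\<^sup>2 \<partial>N))
    = (\<Sum>m\<in>?M. \<Sum>i<n. \<Sum>a\<in>{0..3}. mean_llr (v a) (\<integral>w. (s m (a, i) w)\<^sup>2 \<partial>N))"
    by (subst (2) sum.swap) (simp add: sum.cartesian_product split_beta')
  also have "\<dots> \<le> (\<Sum>m\<in>?M. \<Sum>i<n. B + (\<Sum>a\<in>{0..3}. \<kappa> a * (energy m a i - P)))"
    by (intro sum_mono mean) auto
  also have "\<dots> \<le> card ?M * (real n * B)"
    using sum_weighted_excess_energy_le_0[OF \<kappa>_nonneg] by (simp add: sum.distrib)
  finally have total_mean: "(\<Sum>m\<in>?M. \<Sum>t\<in>I. mean_llr (v (fst t)) (\<integral>w. (s m t w)\<^sup>2 \<partial>N))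
      \<le> card ?M * (real n * B)" .
  have "ln ?K \<le> log_size_bound (real n * B) (1 - \<epsilon>)"
  proof (rule shear_converse[where M="?M" and s=s and G=correct and genie=genie and v="\<lambda>t. v (fst t)"])
    show "m = m'" if m: "m \<in> ?M" "m' \<in> ?M" and genie: "genie m = genie m'"
      and w: "w \<in> correct m" "w' \<in> correct m'"
      and same_obs: "shear I (s m) w = shear I (s m') w'" for m m' w w'
      using recover[OF genie_row_eq[OF m genie] same_obs] by (intro decode_triple[OF m genie w]) simp_all
    show "real (card (genie ` ?M)) * ?K \<le> real (card ?M)"
      using card_genie_mult_le by (simp only: of_nat_mult[symmetric] of_nat_le_iff)
  qed (use \<epsilon>_less_1 v_pos causal square_int card_msgs_pos[of n R] correct_sets
      sum_measure_correct total_mean in \<open>auto simp: nmsg_pos finite_msgs\<close>)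
  with rate show ?thesis
    by (rule order_trans)
qed

end

lemma Cap_mult_ln_2: "Cap x * ln 2 = ln (1 + x) / 2"
  by (simp add: Cap_def log_def)

subsection \<open>The broadcast bound\<close>

context y_channel_triple
begin

abbreviation var_j :: real where
  "var_j \<equiv> 1 + (g j)\<^sup>2 * P"

abbreviation var_jl :: real where
  "var_jl \<equiv> 1 + ((g j)\<^sup>2 + (g l)\<^sup>2) * P"

text \<open>For a relay input of power \<open>P\<close>, the best linear estimate of \<open>Y\<^sub>l\<close> given \<open>Y\<^sub>j\<close> is \<open>\<rho> Y\<^sub>j\<close>, and the
  residual \<open>Y\<^sub>l - \<rho> Y\<^sub>j\<close> has variance \<open>var_jl / var_j\<close>.\<close>
definition mmse_coeff :: real (\<open>\<rho>\<close>) where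
  "\<rho> = P * g l * g j / var_j"

definition broadcast_shift :: "(nat \<Rightarrow> nat \<Rightarrow> nat) \<Rightarrow> nat \<times> nat \<Rightarrow> (nat \<times> nat \<Rightarrow> real) \<Rightarrow> real" where
  "broadcast_shift m t w =
    (if fst t = j then g j * X m w 0 (snd t)
     else if fst t = l then (g l - \<rho> * g j) * X m w 0 (snd t) - \<rho> * w (j, snd t)
     else 0)"

definition broadcast_rank :: "nat \<times> nat \<Rightarrow> nat" where
  "broadcast_rank t = 2 * snd t + (if fst t = l then 1 else 0)"

definition broadcast_var :: "nat \<Rightarrow> real" where
  "broadcast_var a = (if a = j then var_j else if a = l then var_jl / var_j else 1)"

lemma var_pos: "var_j > 0" "var_jl > 0"
  using P_pos by (auto intro!: add_pos_nonneg)

lemma residual_variance: "(g l - \<rho> * g j)\<^sup>2 * P + \<rho>\<^sup>2 + 1 = var_jl / var_j"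
proof -
  have "g l - \<rho> * g j = g l / var_j"
    using var_pos(1) by (simp add: mmse_coeff_def field_simps power2_eq_square)
  then have "(g l - \<rho> * g j)\<^sup>2 * P + \<rho>\<^sup>2 = (g l)\<^sup>2 * P * var_j / var_j\<^sup>2"
    by (simp add: mmse_coeff_def power_divide power_mult_distrib add_divide_distrib[symmetric])
      (simp add: algebra_simps power2_eq_square)
  also have "\<dots> = (g l)\<^sup>2 * P / var_j"
    using var_pos(1) by (simp add: power2_eq_square)
  finally show ?thesis
    using var_pos(1) by (simp add: field_simps)
qed

lemma causal_broadcast_shift:
  assumes m: "m \<in> msgs n R"
  shows "causal broadcast_rank I (broadcast_shift m)"
  unfolding causal_def
proof (intro ballI conjI allI impI)
  fix t assume "t \<in> I"
  then have i: "snd t < n"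
    by auto
  have [measurable]: "(\<lambda>w. X m w 0 (snd t)) \<in> borel_measurable (borel_pi I)"
    using inp_measurable[OF m i, of 0] by (simp add: measurable_std_gaussian_pi)
  have [measurable]: "(\<lambda>w. w (j, snd t)) \<in> borel_measurable (borel_pi I)"
    using i nodes_eq by (intro measurable_component_singleton) auto
  show "broadcast_shift m t \<in> borel_measurable (borel_pi I)"
    unfolding broadcast_shift_def by measurable
  fix w w' :: "nat \<times> nat \<Rightarrow> real"
  assume eq: "\<forall>u\<in>I. broadcast_rank u < broadcast_rank t \<longrightarrow> w u = w' u"
  have "X m w 0 (snd t) = X m w' 0 (snd t)"
    using i by (intro inp_cong eq[rule_format]) (auto simp: broadcast_rank_def)
  moreover have "w (j, snd t) = w' (j, snd t)" if "fst t = l"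
    using i that nodes_eq users_distinct by (intro eq[rule_format]) (auto simp: broadcast_rank_def)
  ultimately show "broadcast_shift m t w = broadcast_shift m t w'"
    by (auto simp: broadcast_shift_def)
qed

lemma broadcast_residual_square_moment:
  assumes m: "m \<in> msgs n R" and i: "i < n"
  shows "integrable N (\<lambda>w. ((g l - \<rho> * g j) * X m w 0 i - \<rho> * w (j, i))\<^sup>2)"
    "(\<integral>w. ((g l - \<rho> * g j) * X m w 0 i - \<rho> * w (j, i))\<^sup>2 \<partial>N) = (g l - \<rho> * g j)\<^sup>2 * energy m 0 i + \<rho>\<^sup>2"
proof -
  have "(j, i) \<in> I"
    using i nodes_eq by auto
  moreover have "X m (w((j, i) := z)) 0 i = X m w 0 i" for w z
    by (rule inp_cong) auto
  ultimately show "integrable N (\<lambda>w. ((g l - \<rho> * g j) * X m w 0 i - \<rho> * w (j, i))\<^sup>2)"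
    "(\<integral>w. ((g l - \<rho> * g j) * X m w 0 i - \<rho> * w (j, i))\<^sup>2 \<partial>N) = (g l - \<rho> * g j)\<^sup>2 * energy m 0 i + \<rho>\<^sup>2"
    using std_gaussian_pi_affine_square_moment[where I=I and t="(j, i)" and X="\<lambda>w. X m w 0 i"
        and a="g l - \<rho> * g j" and b="- \<rho>"]
      inp_measurable[OF m i, of 0] inp_square_integrable[OF m i, of 0]
    by (simp_all add: energy_def)
qed

lemma broadcast_shift_square_integrable:
  assumes m: "m \<in> msgs n R" and t: "t \<in> I"
  shows "integrable N (\<lambda>w. (broadcast_shift m t w)\<^sup>2)"
proof -
  have i: "snd t < n"
    using t by auto
  consider "fst t = j" | "fst t = l" "fst t \<noteq> j" | "fst t \<noteq> j" "fst t \<noteq> l"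
    by blast
  then show ?thesis
    using inp_square_integrable[OF m i, of 0] broadcast_residual_square_moment(1)[OF m i]
    by cases (simp_all add: broadcast_shift_def power_mult_distrib)
qed

lemma broadcast_mean_llr:
  assumes m: "m \<in> msgs n R" and i: "i < n"
  shows "(\<Sum>a\<in>{0..3}. mean_llr (broadcast_var a) (\<integral>w. (broadcast_shift m (a, i) w)\<^sup>2 \<partial>N))
    = ln var_jl / 2
      + ((g j)\<^sup>2 / (2 * var_j) + (g l - \<rho> * g j)\<^sup>2 / (2 * (var_jl / var_j))) * (energy m 0 i - P)"
proof -
  let ?e = "energy m 0 i"
  have mean_j: "mean_llr var_j ((g j)\<^sup>2 * ?e) = ln var_j / 2 + (g j)\<^sup>2 / (2 * var_j) * (?e - P)"
    using mean_llr_affine[OF var_pos(1), of "(g j)\<^sup>2" P 0] by simp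
  have mean_l: "mean_llr (var_jl / var_j) ((g l - \<rho> * g j)\<^sup>2 * ?e + \<rho>\<^sup>2)
      = ln (var_jl / var_j) / 2 + (g l - \<rho> * g j)\<^sup>2 / (2 * (var_jl / var_j)) * (?e - P)"
    using var_pos by (intro mean_llr_affine residual_variance[symmetric]) simp
  have "(\<Sum>a\<in>{0..3}. mean_llr (broadcast_var a) (\<integral>w. (broadcast_shift m (a, i) w)\<^sup>2 \<partial>N))
    = mean_llr var_j ((g j)\<^sup>2 * ?e) + mean_llr (var_jl / var_j) ((g l - \<rho> * g j)\<^sup>2 * ?e + \<rho>\<^sup>2)"
    using users_distinct broadcast_residual_square_moment(2)[OF m i]
    by (simp add: sum_nodes broadcast_shift_def broadcast_var_def power_mult_distrib
        mean_llr_eq energy_def)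
  also have "\<dots> = ln var_jl / 2
      + ((g j)\<^sup>2 / (2 * var_j) + (g l - \<rho> * g j)\<^sup>2 / (2 * (var_jl / var_j))) * (?e - P)"
    unfolding mean_j mean_l using var_pos by (simp add: ln_div distrib_right diff_divide_distrib)
  finally show ?thesis .
qed

lemma broadcast_shift_recovers_outputs:
  assumes shear: "shear I (broadcast_shift m) w = shear I (broadcast_shift m') w'"
  shows "Y m w j n = Y m' w' j n" "Y m w l n = Y m' w' l n"
proof -
  have obs: "broadcast_shift m (a, i) w + w (a, i) = broadcast_shift m' (a, i) w' + w' (a, i)"
    if "a \<in> {j, l}" "i < n" for a i
    using fun_cong[OF shear, of "(a, i)"] that nodes_eq by (auto simp: shear_def)
  have obs_j: "g j * X m w 0 i + w (j, i) = g j * X m' w' 0 i + w' (j, i)" if "i < n" for i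
    using obs[of j i] that by (simp add: broadcast_shift_def)
  have obs_l: "g l * X m w 0 i + w (l, i) = g l * X m' w' 0 i + w' (l, i)" if "i < n" for i
  proof -
    have split: "g l * x + z = ((g l - \<rho> * g j) * x - \<rho> * y + z) + \<rho> * (g j * x + y)" for x y z
      by (simp add: algebra_simps)
    show ?thesis
      unfolding split[of "X m w 0 i" "w (l, i)" "w (j, i)"]
        split[of "X m' w' 0 i" "w' (l, i)" "w' (j, i)"]
      using obs[of l i] obs_j[OF that] that users_distinct by (simp add: broadcast_shift_def)
  qed
  show "Y m w j n = Y m' w' j n" "Y m w l n = Y m' w' l n"
    using obs_j obs_l by (simp_all add: hist_user users_eq)
qed

lemma broadcast_code_bound:
  assumes "\<epsilon> < 1"
  shows "real n * (R k j + R l j + R k l) * ln 2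
    \<le> log_size_bound (real n * (Cap (((g j)\<^sup>2 + (g l)\<^sup>2) * P) * ln 2)) (1 - \<epsilon>)"
proof (rule genie_aided_converse[OF assms causal_broadcast_shift broadcast_shift_square_integrable])
  let ?\<kappa> = "\<lambda>a::nat. if a = 0
    then (g j)\<^sup>2 / (2 * var_j) + (g l - \<rho> * g j)\<^sup>2 / (2 * (var_jl / var_j)) else 0"
  show "broadcast_var a > 0" "?\<kappa> a \<ge> 0" for a
    using var_pos by (auto simp: broadcast_var_def)
  show "(\<Sum>a\<in>{0..3}. mean_llr (broadcast_var a) (\<integral>w. (broadcast_shift m (a, i) w)\<^sup>2 \<partial>N))
    \<le> Cap (((g j)\<^sup>2 + (g l)\<^sup>2) * P) * ln 2 + (\<Sum>a\<in>{0..3}. ?\<kappa> a * (energy m a i - P))"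
    if "m \<in> msgs n R" "i < n" for m i
    using users_distinct unfolding broadcast_mean_llr[OF that] Cap_mult_ln_2 by (simp add: sum_nodes)
  show "Y m w j n = Y m' w' j n \<and> Y m w l n = Y m' w' l n"
    if "shear I (broadcast_shift m) w = shear I (broadcast_shift m') w'" for m m' w w'
    using broadcast_shift_recovers_outputs[OF that] ..
qed

end

subsection \<open>The multiple-access bound\<close>

lemma weighted_sum_square_le:
  fixes a b x y :: real
  shows "(a * x + b * y)\<^sup>2 \<le> (\<bar>a\<bar> + \<bar>b\<bar>) * (\<bar>a\<bar> * x\<^sup>2 + \<bar>b\<bar> * y\<^sup>2)"
proof -
  have "2 * (a * x) * (b * y) \<le> 2 * \<bar>a * x\<bar> * \<bar>b * y\<bar>"
    using abs_ge_self[of "a * x * (b * y)"] by (simp add: abs_mult)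
  also have "\<dots> = \<bar>a\<bar> * \<bar>b\<bar> * (2 * \<bar>x\<bar> * \<bar>y\<bar>)"
    by (simp add: abs_mult)
  also have "\<dots> \<le> \<bar>a\<bar> * \<bar>b\<bar> * (x\<^sup>2 + y\<^sup>2)"
    using sum_squares_bound[of "\<bar>x\<bar>" "\<bar>y\<bar>"] by (intro mult_left_mono) auto
  finally have "(a * x + b * y)\<^sup>2 \<le> \<bar>a\<bar>\<^sup>2 * x\<^sup>2 + \<bar>b\<bar>\<^sup>2 * y\<^sup>2 + \<bar>a\<bar> * \<bar>b\<bar> * (x\<^sup>2 + y\<^sup>2)"
    by (simp add: power2_sum power_mult_distrib)
  then show ?thesis
    by (simp add: power2_eq_square algebra_simps)
qed

lemma weighted_sum_square_moment_le:
  fixes f h :: "'a \<Rightarrow> real"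
  assumes [measurable]: "f \<in> borel_measurable M" "h \<in> borel_measurable M"
    and f_square_int: "integrable M (\<lambda>x. (f x)\<^sup>2)" and h_square_int: "integrable M (\<lambda>x. (h x)\<^sup>2)"
  shows "integrable M (\<lambda>x. (a * f x + b * h x)\<^sup>2)"
    and "(\<integral>x. (a * f x + b * h x)\<^sup>2 \<partial>M)
      \<le> (\<bar>a\<bar> + \<bar>b\<bar>) * (\<bar>a\<bar> * (\<integral>x. (f x)\<^sup>2 \<partial>M) + \<bar>b\<bar> * (\<integral>x. (h x)\<^sup>2 \<partial>M))"
proof -
  let ?bound = "\<lambda>x. (\<bar>a\<bar> + \<bar>b\<bar>) * (\<bar>a\<bar> * (f x)\<^sup>2 + \<bar>b\<bar> * (h x)\<^sup>2)"
  have bound: "integrable M ?bound"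
    using f_square_int h_square_int by simp
  show square: "integrable M (\<lambda>x. (a * f x + b * h x)\<^sup>2)"
    by (rule Bochner_Integration.integrable_bound[OF bound])
      (auto intro!: weighted_sum_square_le[THEN order_trans])
  have "(\<integral>x. (a * f x + b * h x)\<^sup>2 \<partial>M) \<le> (\<integral>x. ?bound x \<partial>M)"
    by (rule integral_mono[OF square bound weighted_sum_square_le])
  then show "(\<integral>x. (a * f x + b * h x)\<^sup>2 \<partial>M)
      \<le> (\<bar>a\<bar> + \<bar>b\<bar>) * (\<bar>a\<bar> * (\<integral>x. (f x)\<^sup>2 \<partial>M) + \<bar>b\<bar> * (\<integral>x. (h x)\<^sup>2 \<partial>M))"
    using f_square_int h_square_int by simp
qed

context y_channel_triple
begin

abbreviation gain_sum :: real where
  "gain_sum \<equiv> \<bar>g k\<bar> + \<bar>g l\<bar>"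

abbreviation var_sum :: real where
  "var_sum \<equiv> 1 + gain_sum\<^sup>2 * P"

text \<open>The relay coordinate is \<open>Y\<^sub>r\<close> without the contribution of user \<open>j\<close>, which the receiver can compute
  step by step because \<open>X\<^sub>j\<close> depends on \<open>m\<^sub>j\<close> and the past of \<open>Y\<^sub>j\<close> only. The other coordinates are bare
  noise.\<close>
definition access_shift :: "(nat \<Rightarrow> nat \<Rightarrow> nat) \<Rightarrow> nat \<times> nat \<Rightarrow> (nat \<times> nat \<Rightarrow> real) \<Rightarrow> real" where
  "access_shift m t w = (if fst t = 0 then g k * X m w k (snd t) + g l * X m w l (snd t) else 0)"

lemma var_sum_pos: "var_sum > 0"
  using P_pos by (auto intro!: add_pos_nonneg)

lemma causal_access_shift:
  assumes m: "m \<in> msgs n R"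
  shows "causal snd I (access_shift m)"
  unfolding causal_def
proof (intro ballI conjI allI impI)
  fix t assume "t \<in> I"
  then have i: "snd t < n"
    by auto
  have [measurable]: "(\<lambda>w. X m w a (snd t)) \<in> borel_measurable (borel_pi I)" if "a \<in> {k, l}" for a
    using inp_measurable[OF m i, of a] that nodes_eq by (auto simp: measurable_std_gaussian_pi)
  show "access_shift m t \<in> borel_measurable (borel_pi I)"
    unfolding access_shift_def by measurable
  fix w w' :: "nat \<times> nat \<Rightarrow> real" assume eq: "\<forall>u\<in>I. snd u < snd t \<longrightarrow> w u = w' u"
  have "X m w a (snd t) = X m w' a (snd t)" for a
    using i by (intro inp_cong eq[rule_format]) auto
  then show "access_shift m t w = access_shift m t w'"
    by (simp add: access_shift_def)
qed

lemma access_signal_square_moment: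
  assumes m: "m \<in> msgs n R" and i: "i < n"
  shows "integrable N (\<lambda>w. (g k * X m w k i + g l * X m w l i)\<^sup>2)"
    "(\<integral>w. (g k * X m w k i + g l * X m w l i)\<^sup>2 \<partial>N)
      \<le> gain_sum * (\<bar>g k\<bar> * energy m k i + \<bar>g l\<bar> * energy m l i)"
proof -
  have kl: "k \<in> {0..3}" "l \<in> {0..3}"
    unfolding nodes_eq by auto
  note moments = weighted_sum_square_moment_le[OF
      inp_measurable[OF m i kl(1)] inp_measurable[OF m i kl(2)]
      inp_square_integrable[OF m i kl(1)] inp_square_integrable[OF m i kl(2)]]
  show "integrable N (\<lambda>w. (g k * X m w k i + g l * X m w l i)\<^sup>2)"
    by (rule moments)
  show "(\<integral>w. (g k * X m w k i + g l * X m w l i)\<^sup>2 \<partial>N)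
      \<le> gain_sum * (\<bar>g k\<bar> * energy m k i + \<bar>g l\<bar> * energy m l i)"
    unfolding energy_def by (rule moments)
qed

lemma access_shift_square_integrable:
  assumes "m \<in> msgs n R" and "t \<in> I"
  shows "integrable N (\<lambda>w. (access_shift m t w)\<^sup>2)"
  using access_signal_square_moment(1)[of m "snd t"] assms
  by (cases "fst t = 0") (auto simp: access_shift_def)

lemma access_mean_llr_le:
  assumes m: "m \<in> msgs n R" and i: "i < n"
  shows "(\<Sum>a\<in>{0..3}. mean_llr (if a = 0 then var_sum else 1) (\<integral>w. (access_shift m (a, i) w)\<^sup>2 \<partial>N))
    \<le> ln var_sum / 2 + (gain_sum * \<bar>g k\<bar> / (2 * var_sum) * (energy m k i - P)
      + gain_sum * \<bar>g l\<bar> / (2 * var_sum) * (energy m l i - P))"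
proof -
  let ?e = "gain_sum * (\<bar>g k\<bar> * energy m k i + \<bar>g l\<bar> * energy m l i)"
  have "(\<Sum>a\<in>{0..3}. mean_llr (if a = 0 then var_sum else 1) (\<integral>w. (access_shift m (a, i) w)\<^sup>2 \<partial>N))
    = mean_llr var_sum (\<integral>w. (g k * X m w k i + g l * X m w l i)\<^sup>2 \<partial>N)"
    using users_distinct by (simp add: sum_nodes access_shift_def mean_llr_eq[of 1])
  also have "\<dots> \<le> ln var_sum / 2 + (?e + 1 - var_sum) / (2 * var_sum)"
    unfolding mean_llr_eq[OF var_sum_pos] using access_signal_square_moment(2)[OF m i] var_sum_pos
    by (intro add_left_mono divide_right_mono diff_right_mono add_right_mono) auto
  also have "?e + 1 - var_sum
    = gain_sum * \<bar>g k\<bar> * (energy m k i - P) + gain_sum * \<bar>g l\<bar> * (energy m l i - P)"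
    by (simp add: power2_eq_square algebra_simps)
  finally show ?thesis
    by (simp add: add_divide_distrib)
qed

lemma access_shift_recovers_outputs:
  assumes mj: "m j = m' j" and shear: "shear I (access_shift m) w = shear I (access_shift m') w'"
    and "i \<le> n"
  shows "Y m w 0 i = Y m' w' 0 i \<and> Y m w j i = Y m' w' j i \<and> Y m w l i = Y m' w' l i"
  using \<open>i \<le> n\<close>
proof (induction i)
  case (Suc i)
  then have i: "i < n"
    and IH: "Y m w 0 i = Y m' w' 0 i" "Y m w j i = Y m' w' j i" "Y m w l i = Y m' w' l i"
    by auto
  have obs: "access_shift m (a, i) w + w (a, i) = access_shift m' (a, i) w' + w' (a, i)"
    if "a \<in> {0..3}" for a
    using fun_cong[OF shear, of "(a, i)"] that i by (simp add: shear_def)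
  have noise: "w (a, i) = w' (a, i)" if "a \<in> {j, l}" for a
    using obs[of a] that users_distinct by (auto simp: nodes_eq access_shift_def)
  have relay: "g k * enc c k i (m k) (Y m w k i) + g l * enc c l i (m l) (Y m w l i) + w (0, i)
    = g k * enc c k i (m' k) (Y m' w' k i) + g l * enc c l i (m' l) (Y m' w' l i) + w' (0, i)"
    using obs[of 0] users_distinct by (simp add: access_shift_def inp_def)
  show ?case
    using IH noise relay mj users_distinct by (simp add: Let_def users_eq)
qed simp

lemma multiple_access_code_bound:
  assumes "\<epsilon> < 1"
  shows "real n * (R k j + R l j + R k l) * ln 2
    \<le> log_size_bound (real n * (Cap ((\<bar>g k\<bar> + \<bar>g l\<bar>)\<^sup>2 * P) * ln 2)) (1 - \<epsilon>)"
proof (rule genie_aided_converse[OF assms causal_access_shift access_shift_square_integrable])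
  let ?v = "\<lambda>a::nat. if a = 0 then var_sum else 1"
  let ?\<kappa> = "\<lambda>a. if a \<in> {k, l} then gain_sum * \<bar>g a\<bar> / (2 * var_sum) else 0"
  show "?v a > 0" "?\<kappa> a \<ge> 0" for a
    using var_sum_pos by auto
  show "(\<Sum>a\<in>{0..3}. mean_llr (?v a) (\<integral>w. (access_shift m (a, i) w)\<^sup>2 \<partial>N))
    \<le> Cap (gain_sum\<^sup>2 * P) * ln 2 + (\<Sum>a\<in>{0..3}. ?\<kappa> a * (energy m a i - P))"
    if "m \<in> msgs n R" "i < n" for m i
    using access_mean_llr_le[OF that] users_distinct unfolding Cap_mult_ln_2 by (simp add: sum_nodes)
  show "Y m w j n = Y m' w' j n \<and> Y m w l n = Y m' w' l n"
    if "m j = m' j" "shear I (access_shift m) w = shear I (access_shift m') w'" for m m' w w'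
    using access_shift_recovers_outputs[OF that order_refl] by blast
qed

end

section \<open>The capacity bound\<close>

lemma achievable_rate_le:
  assumes "achievable h1 h2 h3 P R"
    and bound: "\<And>n c. valid_code h1 h2 h3 P n R c \<Longrightarrow> n > 0 \<Longrightarrow> perr h1 h2 h3 n R c < 1 \<Longrightarrow>
      real n * x * ln 2 \<le> log_size_bound (real n * (B * ln 2)) (1 - perr h1 h2 h3 n R c)"
  shows "x \<le> B"
proof -
  obtain cs where valid: "\<And>n. valid_code h1 h2 h3 P n R (cs n)"
    and perr: "(\<lambda>n. perr h1 h2 h3 n R (cs n)) \<longlonglongrightarrow> 0"
    using assms(1) by (auto simp: achievable_def)
  have "x * ln 2 \<le> B * ln 2"
  proof (rule log_size_bound_asymptotic[OF perr])
    show "real n * (x * ln 2) \<le> log_size_bound (real n * (B * ln 2)) (1 - perr h1 h2 h3 n R (cs n))"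
      if "n > 0" "perr h1 h2 h3 n R (cs n) < 1" for n
      using bound[OF valid that] by (simp only: mult.assoc)
  qed
  then show ?thesis
    by simp
qed

lemma achievable_triple_rate_le:
  assumes R: "achievable h1 h2 h3 P R" and "P > 0" and "users = {j, k, l}"
  shows broadcast_bound:
      "R k j + R l j + R k l \<le> Cap (((gain h1 h2 h3 j)\<^sup>2 + (gain h1 h2 h3 l)\<^sup>2) * P)"
    and multiple_access_bound:
      "R k j + R l j + R k l \<le> Cap ((\<bar>gain h1 h2 h3 k\<bar> + \<bar>gain h1 h2 h3 l\<bar>)\<^sup>2 * P)"
proof -
  have triple: "y_channel_triple h1 h2 h3 P n R c j k l" if "valid_code h1 h2 h3 P n R c" "n > 0" for n c
    using assms that by unfold_locales
  show "R k j + R l j + R k l \<le> Cap (((gain h1 h2 h3 j)\<^sup>2 + (gain h1 h2 h3 l)\<^sup>2) * P)"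
    by (rule achievable_rate_le[OF R y_channel_triple.broadcast_code_bound[OF triple]])
  show "R k j + R l j + R k l \<le> Cap ((\<bar>gain h1 h2 h3 k\<bar> + \<bar>gain h1 h2 h3 l\<bar>)\<^sup>2 * P)"
    by (rule achievable_rate_le[OF R y_channel_triple.multiple_access_code_bound[OF triple]])
qed

theorem theorem2:
  fixes h1 h2 h3 P :: real
  assumes "h1\<^sup>2 \<ge> h2\<^sup>2" and "h2\<^sup>2 \<ge> h3\<^sup>2" and "P > 0"
  shows "sum_capacity h1 h2 h3 P
           \<le> ereal (Cap ((h2\<^sup>2 + h3\<^sup>2) * P)
                    + Cap (min (h1\<^sup>2 + h3\<^sup>2) ((\<bar>h2\<bar> + \<bar>h3\<bar>)\<^sup>2) * P))"
  unfolding sum_capacity_def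
proof (rule SUP_least)
  fix R assume "R \<in> {R. achievable h1 h2 h3 P R}"
  then have R: "achievable h1 h2 h3 P R"
    by simp
  have pairs: "pairs = {(1, 2), (1, 3), (3, 2), (2, 1), (3, 1), (2, 3)}"
    by (auto simp: pairs_def users_def)
  have users: "users = {2, 1, 3}" "users = {1, 2, 3}"
    by (auto simp: users_def)
  have "R 1 2 + R 3 2 + R 1 3 \<le> Cap ((h2\<^sup>2 + h3\<^sup>2) * P)"
    using broadcast_bound[OF R assms(3) users(1)] by (simp add: gain_def)
  moreover have "R 2 1 + R 3 1 + R 2 3 \<le> Cap ((h1\<^sup>2 + h3\<^sup>2) * P)"
    using broadcast_bound[OF R assms(3) users(2)] by (simp add: gain_def)
  moreover have "R 2 1 + R 3 1 + R 2 3 \<le> Cap ((\<bar>h2\<bar> + \<bar>h3\<bar>)\<^sup>2 * P)"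
    using multiple_access_bound[OF R assms(3) users(2)] by (simp add: gain_def)
  ultimately show "ereal (\<Sum>(j, k)\<in>pairs. R j k) \<le> ereal (Cap ((h2\<^sup>2 + h3\<^sup>2) * P)
      + Cap (min (h1\<^sup>2 + h3\<^sup>2) ((\<bar>h2\<bar> + \<bar>h3\<bar>)\<^sup>2) * P))"
    by (simp add: pairs min_def)
qed

end
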